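(* Let $n\ge 2$ be an integer. If $A$ is a symmetric and irreducible $n\times n$ matrix over a field $\mathbb{K}$, then the family $\mathcal{H}_A$ of HL-bipartitions of $A$ is bipartitive. Conversely, if $\mathcal{F}$ is a weakly bipartitive family of bipartitions of $[n]$, then there exists an irreducible $n\times n$ matrix $A$ with entries in $\{-1,0,1\}$ (regarded as a real matrix) such that $\mathcal{F}=\mathcal{H}_A$. In the particular case when $\mathcal{F}$ is bipartitive, the matrix $A$ can be chosen symmetric.
   Context: $[n]:=\{1,\dots,n\}$. A bipartition of a set $V$ is an unordered partition $\{X,Y\}$ of $V$ into two nonempty parts. For an $n\times n$ matrix $A$ over a field and nonempty $X,Y\subseteq[n]$, $A[X,Y]$ denotes the submatrix of $A$ with row indices in $X$ and column indices in $Y$. The matrix $A$ is irreducible if for every nonempty proper subset $X$ of $[n]$, both matrices $A[X,[n]\setminus X]$ and $A[[n]\setminus X,X]$ are nonzero. An HL-bipartition of $A$ is a bipartition $\{X,Y\}$ of $[n]$ such that both $A[X,Y]$ and $A[Y,X]$ have rank at most $1$. The family of HL-bipartitions of $A$ is denoted $\mathcal{H}_A$. Two bipartitions $\{X,Y\}$ and $\{X',Y'\}$ of $V$ overlap if $X\cap X'$, $X\cap Y'$, $Y\cap X'$ and $Y\cap Y'$ are all nonempty. A family $\mathcal{F}$ of bipartitions of $V$ is weakly bipartitive if: (Q1) for all $v\in V$, $\{\{v\},V\setminus\{v\}\}\in\mathcal{F}$; (Q2) for all $\{X,Y\},\{X',Y'\}\in\mathcal{F}$ that overlap, the four bipartitions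 $\{X\cap X',Y\cup Y'\}$, $\{X\cap Y',Y\cup X'\}$, $\{Y\cap X',X\cup Y'\}$ and $\{Y\cap Y',X\cup X'\}$ are in $\mathcal{F}$. A weakly bipartitive family $\mathcal{F}$ is bipartitive if in addition: (Q3) for all $\{X,Y\},\{X',Y'\}\in\mathcal{F}$ that overlap, $\{X\Delta X',X\Delta Y'\}\in\mathcal{F}$, where $\Delta$ denotes symmetric difference. *)

theory Defs
  imports
    Complex_Main
    "HOL-Library.Disjoint_Sets"
    "Jordan_Normal_Form.DL_Rank"
    "Jordan_Normal_Form.DL_Submatrix"
begin

(* Matrices are indexed from 0, so the index set [n] = {1,...,n} is rendered as {0..<n}.
   An unordered bipartition {X, Y} is the two-element set of sets {X, Y}; since partition_on
   requires the parts to be nonempty and disjoint, card P = 2 gives exactly two parts. *)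

definition bipartition :: "'v set \<Rightarrow> 'v set set \<Rightarrow> bool" where
  "bipartition V P \<longleftrightarrow> partition_on V P \<and> card P = 2"

definition overlap :: "'v set \<Rightarrow> 'v set \<Rightarrow> 'v set \<Rightarrow> 'v set \<Rightarrow> bool" where
  "overlap X Y X' Y' \<longleftrightarrow>
     X \<inter> X' \<noteq> {} \<and> X \<inter> Y' \<noteq> {} \<and> Y \<inter> X' \<noteq> {} \<and> Y \<inter> Y' \<noteq> {}"

definition weakly_bipartitive :: "'v set \<Rightarrow> 'v set set set \<Rightarrow> bool" where
  "weakly_bipartitive V F \<longleftrightarrow>
     (\<forall>P\<in>F. bipartition V P) \<and>
     (\<forall>v\<in>V. {{v}, V - {v}} \<in> F) \<and>
     (\<forall>X Y X' Y'. {X, Y} \<in> F \<and> {X', Y'} \<in> F \<and> overlap X Y X' Y' \<longrightarrow>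
        {X \<inter> X', Y \<union> Y'} \<in> F \<and> {X \<inter> Y', Y \<union> X'} \<in> F \<and>
        {Y \<inter> X', X \<union> Y'} \<in> F \<and> {Y \<inter> Y', X \<union> X'} \<in> F)"

definition bipartitive :: "'v set \<Rightarrow> 'v set set set \<Rightarrow> bool" where
  "bipartitive V F \<longleftrightarrow>
     weakly_bipartitive V F \<and>
     (\<forall>X Y X' Y'. {X, Y} \<in> F \<and> {X', Y'} \<in> F \<and> overlap X Y X' Y' \<longrightarrow>
        {sym_diff X X', sym_diff X Y'} \<in> F)"

(* vec_space.rank takes the length of the columns as its first argument. *)

definition mat_rank :: "'k::field mat \<Rightarrow> nat" where
  "mat_rank A = vec_space.rank (dim_row A) A"

(* The next two notions are meant for square matrices A, with index set {0..<dim_row A}. *)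

definition irreducible_mat :: "'k::zero mat \<Rightarrow> bool" where
  "irreducible_mat A \<longleftrightarrow>
     (\<forall>X. X \<noteq> {} \<and> X \<subset> {0..<dim_row A} \<longrightarrow>
        (let Y = {0..<dim_row A} - X in
           submatrix A X Y \<noteq> 0\<^sub>m (card X) (card Y) \<and>
           submatrix A Y X \<noteq> 0\<^sub>m (card Y) (card X)))"

definition HL_bipartitions :: "'k::field mat \<Rightarrow> nat set set set" where
  "HL_bipartitions A =
     {{X, Y} | X Y. bipartition {0..<dim_row A} {X, Y} \<and>
        mat_rank (submatrix A X Y) \<le> 1 \<and> mat_rank (submatrix A Y X) \<le> 1}"

end

theory Submission
  imports Defs "Jordan_Normal_Form.DL_Rank_Submatrix"
begin

text \<open>
  A matrix has rank at most one exactly when all its $2 \times 2$ minors vanish, so being an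
  HL-bipartition is a family of polynomial identities between entries.

  Symmetric irreducible matrices give bipartitive families. Two overlapping HL-bipartitions split
  the index set into four blocks $P, Q, R, S$. Irreducibility provides a nonzero entry between $S$
  and the rest, which ties the two rank-one blocks containing the rows $P$ together; this is the
  corner property (Q2), see \<open>HL_corner\<close>. For (Q3) the only minors that are not already
  covered by a corner have one index in each of $P, Q, R, S$, and the two given bipartitions say
  that, of the three ways to pair the four blocks, two pairs of products agree; by symmetry of the
  matrix, so does the remaining pair, see \<open>minors_vanish_diagonal\<close>.

  For the converse, choose a vertex $v$ and keep from every bipartition the part avoiding $v$. A
  weakly bipartitive family on $V$ becomes a weakly partitive family on $V \setminus \{v\}$:
  it contains the singletons and the whole set, and with two crossing members their intersection,
  union and differences. If row and column $v$ of a matrix consist of ones, a block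
  containing part of that row or column has rank one only if it is constant along the other
  direction; hence the HL-bipartitions of the matrix correspond to the modules of its restriction to
  $V \setminus \{v\}$, that is, to the sets whose elements no outside element can tell apart.
  What is left is that every weakly partitive family is the family of modules of a matrix with
  entries $-1, 0, 1$, which can be symmetric if the family is also closed under symmetric
  differences of crossing members: \<open>weakly_partitive_representation\<close>.

  This is proved by induction on the ground set. A member is strong if no member crosses it.
  If there is a strong member $Z$ other than the ground set and the singletons, every member lies
  in $Z$, or is a union of classes once $Z$ is contracted to a point; representations of these two
  smaller families are glued along $Z$. Gluing may create unwanted modules crossing $Z$, but only if
  the pair of entries across some cut of $Z$ is also the pair of entries between the contracted point
  and the rest of some module through it. Both pairs are unique up to order, and with three available values a transposition of values inside $Z$
  makes them differ (\<open>recolour_to_avoid\<close>). If no such $Z$ exists, the family is trivial, or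
  consists of all nonempty subsets, or of the intervals of a linear order
  (\<open>strong_free_trichotomy\<close>), and each case has an explicit matrix: a path with
  one distinguished edge, a constant matrix, and the sign matrix of the order.
\<close>

section \<open>Blocks of rank at most one\<close>

definition minors_vanish :: "('a \<Rightarrow> 'a \<Rightarrow> 'k::field) \<Rightarrow> 'a set \<Rightarrow> 'a set \<Rightarrow> bool" where
  "minors_vanish a X Y \<longleftrightarrow>
     (\<forall>x\<in>X. \<forall>x'\<in>X. \<forall>y\<in>Y. \<forall>y'\<in>Y. a x y * a x' y' = a x y' * a x' y)"

lemma det_two_by_two:
  fixes A :: "'k::field mat"
  assumes A: "A \<in> carrier_mat 2 2"
  shows "det A = A $$ (0,0) * A $$ (1,1) - A $$ (0,1) * A $$ (1,0)"
proof -
  have "mat_delete A 0 j \<in> carrier_mat 1 1" for j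
    using mat_delete_carrier[of A 2 2 0 j] A by simp
  then have cof: "cofactor A 0 j = (- 1) ^ j * (mat_delete A 0 j) $$ (0,0)" for j
    by (simp add: cofactor_def det_single)
  have "det A = (\<Sum>j<2. A $$ (0,j) * cofactor A 0 j)"
    by (rule laplace_expansion_row[OF A]) simp
  also have "{..<2} = {0, Suc 0}" by auto
  finally show ?thesis
    using A by (simp add: cof mat_delete_def)
qed

lemma pick_image:
  assumes "finite X"
  shows "pick X ` {..<card X} = X"
proof
  show "pick X ` {..<card X} \<subseteq> X" using pick_in_set by auto
  show "X \<subseteq> pick X ` {..<card X}"
  proof
    fix x assume "x \<in> X"
    then have "{a \<in> X. a < x} \<subset> X" by auto
    then have "card {a \<in> X. a < x} < card X" by (rule psubset_card_mono[OF assms])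
    then show "x \<in> pick X ` {..<card X}"
      using pick_card_in_set[OF \<open>x \<in> X\<close>] by (intro image_eqI[where x = "card {a \<in> X. a < x}"]) simp_all
  qed
qed

text \<open>
  A nonvanishing $2 \times 2$ minor forces rank at least two. The row and column pairs are
  ordered because the submatrix on an index set lists its indices increasingly.
\<close>
lemma two_by_two_minor_zero_of_rank_le_1:
  fixes B :: "'k::field mat"
  assumes rank: "mat_rank B \<le> 1"
    and ij: "i < i'" "i' < dim_row B" "j < j'" "j' < dim_col B"
  shows "B $$ (i,j) * B $$ (i',j') = B $$ (i,j') * B $$ (i',j)"
proof (rule ccontr)
  assume ne: "\<not> ?thesis"
  let ?S = "submatrix B {i,i'} {j,j'}"
  have I: "{k. k < dim_row B \<and> k \<in> {i,i'}} = {i,i'}" "{k. k < dim_col B \<and> k \<in> {j,j'}} = {j,j'}"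
    using ij by auto
  have c: "card {i,i'} = 2" "card {j,j'} = 2" using ij by auto
  have p: "pick {k,k'} 0 = k" "pick {k,k'} (Suc 0) = k'" if "k < k'" for k k' :: nat
  proof -
    have e: "{a \<in> {k,k'}. a < k} = {}" "{a \<in> {k,k'}. a < k'} = {k}" using that by auto
    show "pick {k,k'} 0 = k" "pick {k,k'} (Suc 0) = k'"
      using pick_card_in_set[of k "{k,k'}"] pick_card_in_set[of k' "{k,k'}"] unfolding e by auto
  qed
  have "?S \<in> carrier_mat 2 2"
    by (rule carrier_matI) (simp_all only: dim_submatrix I c)
  then have "det ?S = ?S $$ (0,0) * ?S $$ (1,1) - ?S $$ (0,1) * ?S $$ (1,0)"
    by (rule det_two_by_two)
  also have "\<dots> = B $$ (i,j) * B $$ (i',j') - B $$ (i,j') * B $$ (i',j)"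
  proof -
    have "?S $$ (k,l) = B $$ (pick {i,i'} k, pick {j,j'} l)" if "k < 2" "l < 2" for k l
      by (rule submatrix_index) (simp_all only: I c that)
    then show ?thesis using ij by (simp add: p del: pick.simps)
  qed
  finally have "det ?S \<noteq> 0" using ne by simp
  then have "card {k. k < dim_col B \<and> k \<in> {j,j'}} \<le> mat_rank B"
    unfolding mat_rank_def by (intro vec_space.rank_gt_minor) auto
  then show False using rank by (simp only: I c)
qed

lemma mat_rank_le_1_iff:
  fixes B :: "'k::field mat"
  shows "mat_rank B \<le> 1 \<longleftrightarrow> (\<forall>i<dim_row B. \<forall>i'<dim_row B. \<forall>j<dim_col B. \<forall>j'<dim_col B.
    B $$ (i,j) * B $$ (i',j') = B $$ (i,j') * B $$ (i',j))"
proof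
  assume r: "mat_rank B \<le> 1"
  show "\<forall>i<dim_row B. \<forall>i'<dim_row B. \<forall>j<dim_col B. \<forall>j'<dim_col B.
    B $$ (i,j) * B $$ (i',j') = B $$ (i,j') * B $$ (i',j)"
  proof (intro allI impI)
    fix i i' j j'
    assume b: "i < dim_row B" "i' < dim_row B" "j < dim_col B" "j' < dim_col B"
    note minor = two_by_two_minor_zero_of_rank_le_1[OF r]
    consider "i = i' \<or> j = j'" | "i < i'" "j < j'" | "i < i'" "j' < j" | "i' < i" "j < j'" | "i' < i" "j' < j"
      by linarith
    then show "B $$ (i,j) * B $$ (i',j') = B $$ (i,j') * B $$ (i',j)"
    proof cases
      case 1 then show ?thesis by auto
    next
      case 2 then show ?thesis using b by (intro minor)
    next
      case 3 show ?thesis using minor[OF 3(1) b(2) 3(2) b(3)] by simp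
    next
      case 4 show ?thesis using minor[OF 4(1) b(1) 4(2) b(4)] by (simp add: mult.commute)
    next
      case 5 show ?thesis using minor[OF 5(1) b(1) 5(2) b(3)] by (simp add: mult.commute)
    qed
  qed
next
  assume m: "\<forall>i<dim_row B. \<forall>i'<dim_row B. \<forall>j<dim_col B. \<forall>j'<dim_col B.
    B $$ (i,j) * B $$ (i',j') = B $$ (i,j') * B $$ (i',j)"
  have "\<exists>f g. \<forall>r<dim_row B. \<forall>c<dim_col B. B $$ (r,c) = f r * g c"
  proof (cases "\<exists>i<dim_row B. \<exists>j<dim_col B. B $$ (i,j) \<noteq> 0")
    case False
    then show ?thesis by (intro exI[of _ "\<lambda>_. 0"]) auto
  next
    case True
    then obtain i j where ij: "i < dim_row B" "j < dim_col B" "B $$ (i,j) \<noteq> 0" by auto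
    \<comment> \<open>The pivot's column and its rescaled row give the factorisation.\<close>
    have "B $$ (r,c) = B $$ (r,j) * (B $$ (i,c) / B $$ (i,j))"
      if "r < dim_row B" "c < dim_col B" for r c
    proof -
      have "B $$ (i,j) * B $$ (r,c) = B $$ (i,c) * B $$ (r,j)" using m ij that by blast
      then show ?thesis using ij(3) by (simp add: field_simps)
    qed
    then show ?thesis 
      by (intro exI[of _ "\<lambda>r. B $$ (r,j)"] exI[of _ "\<lambda>c. B $$ (i,c) / B $$ (i,j)"] allI impI)
  qed
  then obtain f g where "\<And>r c. r < dim_row B \<Longrightarrow> c < dim_col B \<Longrightarrow> B $$ (r,c) = f r * g c" by blast
  then show "mat_rank B \<le> 1"
    unfolding mat_rank_def by (intro vec_space.rank_le_1_product_entries[of B]) auto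
qed

lemma submatrix_shape:
  assumes A: "A \<in> carrier_mat n n" and X: "X \<subseteq> {0..<n}" and Y: "Y \<subseteq> {0..<n}"
  shows "dim_row (submatrix A X Y) = card X" "dim_col (submatrix A X Y) = card Y"
    and "\<And>i j. i < card X \<Longrightarrow> j < card Y \<Longrightarrow> submatrix A X Y $$ (i,j) = A $$ (pick X i, pick Y j)"
proof -
  have I: "{i. i < n \<and> i \<in> X} = X" "{i. i < n \<and> i \<in> Y} = Y" using X Y by auto
  show "dim_row (submatrix A X Y) = card X" "dim_col (submatrix A X Y) = card Y"
    using A by (simp_all add: dim_submatrix I)
  show "submatrix A X Y $$ (i,j) = A $$ (pick X i, pick Y j)" if "i < card X" "j < card Y" for i j
    using that A by (simp add: submatrix_index I)
qed

lemma ball_iff_pick: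
  assumes "finite X"
  shows "(\<forall>x\<in>X. P x) \<longleftrightarrow> (\<forall>i<card X. P (pick X i))"
  by (subst (1) pick_image[OF assms, symmetric]) auto

lemma submatrix_rank_le_1_iff:
  fixes A :: "'k::field mat"
  assumes A: "A \<in> carrier_mat n n" and X: "X \<subseteq> {0..<n}" and Y: "Y \<subseteq> {0..<n}"
  shows "mat_rank (submatrix A X Y) \<le> 1 \<longleftrightarrow> minors_vanish (\<lambda>i j. A $$ (i,j)) X Y"
proof -
  have fin: "finite X" "finite Y" using X Y finite_subset by blast+
  show ?thesis
    unfolding mat_rank_le_1_iff minors_vanish_def ball_iff_pick[OF fin(1)] ball_iff_pick[OF fin(2)]
      submatrix_shape(1,2)[OF A X Y]
    by (intro all_cong1 imp_cong refl) (simp only: submatrix_shape(3)[OF A X Y])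
qed

lemma submatrix_eq_zero_iff:
  fixes A :: "'k::field mat"
  assumes A: "A \<in> carrier_mat n n" and X: "X \<subseteq> {0..<n}" and Y: "Y \<subseteq> {0..<n}"
  shows "submatrix A X Y = 0\<^sub>m (card X) (card Y) \<longleftrightarrow> (\<forall>x\<in>X. \<forall>y\<in>Y. A $$ (x,y) = 0)"
proof -
  have fin: "finite X" "finite Y" using X Y finite_subset by blast+
  show ?thesis
    unfolding mat_eq_iff ball_iff_pick[OF fin(1)] ball_iff_pick[OF fin(2)]
    by (auto simp: submatrix_shape[OF A X Y])
qed

lemma bipartition_doubleton_iff:
  "bipartition V {X,Y} \<longleftrightarrow> X \<noteq> {} \<and> Y \<noteq> {} \<and> X \<inter> Y = {} \<and> X \<union> Y = V"
proof -
  have "card {X,Y} = 2 \<longleftrightarrow> X \<noteq> Y" by (cases "X = Y") auto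
  then show ?thesis
    unfolding bipartition_def partition_on_def disjoint_def by (cases "X = Y") auto
qed

lemma HL_bipartitions_iff:
  fixes A :: "'k::field mat"
  assumes A: "A \<in> carrier_mat n n"
  shows "{X,Y} \<in> HL_bipartitions A \<longleftrightarrow> X \<noteq> {} \<and> Y \<noteq> {} \<and> X \<inter> Y = {} \<and> X \<union> Y = {0..<n} \<and>
    minors_vanish (\<lambda>i j. A $$ (i,j)) X Y \<and> minors_vanish (\<lambda>i j. A $$ (i,j)) Y X"
proof -
  have "{X,Y} \<in> HL_bipartitions A \<longleftrightarrow> bipartition {0..<n} {X,Y} \<and>
      mat_rank (submatrix A X Y) \<le> 1 \<and> mat_rank (submatrix A Y X) \<le> 1"
    (is "_ \<longleftrightarrow> ?H X Y")
  proof
    assume "{X,Y} \<in> HL_bipartitions A"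
    then obtain X' Y' where e: "{X,Y} = {X',Y'}" and h: "?H X' Y'"
      using A unfolding HL_bipartitions_def by auto
    from e have "X = X' \<and> Y = Y' \<or> X = Y' \<and> Y = X'" by (simp add: doubleton_eq_iff)
    then show "?H X Y" using h by (metis insert_commute)
  qed (use A in \<open>auto simp: HL_bipartitions_def\<close>)
  then show ?thesis
    using submatrix_rank_le_1_iff[OF A, of X Y] submatrix_rank_le_1_iff[OF A, of Y X]
    unfolding bipartition_doubleton_iff by blast
qed

lemma irreducible_mat_iff:
  fixes A :: "'k::field mat"
  assumes A: "A \<in> carrier_mat n n"
  shows "irreducible_mat A \<longleftrightarrow> (\<forall>X Y. X \<noteq> {} \<and> Y \<noteq> {} \<and> X \<inter> Y = {} \<and> X \<union> Y = {0..<n} \<longrightarrow>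
    (\<exists>x\<in>X. \<exists>y\<in>Y. A $$ (x,y) \<noteq> 0))" (is "?l \<longleftrightarrow> ?r")
proof
  assume l: ?l
  show ?r
  proof (intro allI impI)
    fix X Y assume h: "X \<noteq> {} \<and> Y \<noteq> {} \<and> X \<inter> Y = {} \<and> X \<union> Y = {0..<n}"
    then have "X \<subset> {0..<n}" "Y = {0..<n} - X" by auto
    then show "\<exists>x\<in>X. \<exists>y\<in>Y. A $$ (x,y) \<noteq> 0"
      using l h A submatrix_eq_zero_iff[OF A, of X Y] unfolding irreducible_mat_def Let_def by auto
  qed
next
  assume r: ?r
  show ?l unfolding irreducible_mat_def Let_def
  proof (intro allI impI)
    fix X assume h: "X \<noteq> {} \<and> X \<subset> {0..<dim_row A}"
    let ?Y = "{0..<dim_row A} - X"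
    have p: "X \<noteq> {}" "?Y \<noteq> {}" "X \<inter> ?Y = {}" "?Y \<inter> X = {}" "X \<union> ?Y = {0..<n}" "?Y \<union> X = {0..<n}"
      using h A by auto
    have "\<exists>x\<in>X. \<exists>y\<in>?Y. A $$ (x,y) \<noteq> 0" "\<exists>x\<in>?Y. \<exists>y\<in>X. A $$ (x,y) \<noteq> 0"
      using r[rule_format, of X ?Y] r[rule_format, of ?Y X] p by blast+
    then show "submatrix A X ?Y \<noteq> 0\<^sub>m (card X) (card ?Y) \<and> submatrix A ?Y X \<noteq> 0\<^sub>m (card ?Y) (card X)"
      using submatrix_eq_zero_iff[OF A, of X ?Y] submatrix_eq_zero_iff[OF A, of ?Y X] h A by auto
  qed
qed

section \<open>HL-bipartitions of symmetric irreducible matrices\<close>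

lemma minors_vanish_mono:
  "minors_vanish a X Y \<Longrightarrow> X' \<subseteq> X \<Longrightarrow> Y' \<subseteq> Y \<Longrightarrow> minors_vanish a X' Y'"
  unfolding minors_vanish_def by blast

lemma minors_vanish_transpose:
  "minors_vanish (\<lambda>i j. a j i) X Y \<longleftrightarrow> minors_vanish a Y X"
  unfolding minors_vanish_def by (metis mult.commute)

text \<open>
  A common column $c$ with a nonzero entry in a row $r$ fixes the proportionality factor of
  every other row to row $r$, and the factor is the same for the columns $C$ and $D$.
\<close>
lemma minors_vanish_Un_cols:
  assumes C: "minors_vanish a P C" and D: "minors_vanish a P D"
    and r: "r \<in> P" "c \<in> C \<inter> D" "a r c \<noteq> 0"
  shows "minors_vanish a P (C \<union> D)"
proof -
  have key: "a x y * a r c = a x c * a r y" if "x \<in> P" "y \<in> C \<union> D" for x y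
    using that r C D unfolding minors_vanish_def by blast
  show ?thesis unfolding minors_vanish_def
  proof (intro ballI)
    fix x x' y y' assume h: "x \<in> P" "x' \<in> P" "y \<in> C \<union> D" "y' \<in> C \<union> D"
    have "(a x y * a r c) * (a x' y' * a r c) = (a x y' * a r c) * (a x' y * a r c)"
      using key h by simp
    then show "a x y * a x' y' = a x y' * a x' y" using r(3) by (simp add: field_simps)
  qed
qed

lemma minors_vanish_add_zero_cols:
  assumes "minors_vanish a P C" and "\<And>x y. x \<in> P \<Longrightarrow> y \<in> D \<Longrightarrow> a x y = 0"
  shows "minors_vanish a P (C \<union> D)"
  using assms unfolding minors_vanish_def by (metis UnE mult_zero_left mult_zero_right)

text \<open>
  The rank of $P \times (Q \cup R)$ is not controlled by either hypothesis alone; the block $P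
  \times S$ links them if it is nonzero. If it vanishes, the given nonzero entry of the columns
  $S$ lies in a row of $Q$ or of $R$, and proportionality to that row wipes out $P \times R$ or
  $P \times Q$.
\<close>
lemma minors_vanish_corner:
  assumes X: "minors_vanish a (P \<union> Q) (R \<union> S)"
    and X': "minors_vanish a (P \<union> R) (Q \<union> S)"
    and nz: "x \<in> P \<union> Q \<union> R" "s \<in> S" "a x s \<noteq> 0"
  shows "minors_vanish a P (Q \<union> R \<union> S)"
proof (cases "\<exists>p\<in>P. \<exists>s\<in>S. a p s \<noteq> 0")
  case True
  then obtain p s where "p \<in> P" "s \<in> S" "a p s \<noteq> 0" by blast
  have "minors_vanish a P (Q \<union> S)" using X' by (rule minors_vanish_mono) auto
  moreover have "minors_vanish a P (R \<union> S)" using X by (rule minors_vanish_mono) auto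
  ultimately have "minors_vanish a P ((Q \<union> S) \<union> (R \<union> S))"
    by (rule minors_vanish_Un_cols[where r = p and c = s])
      (use \<open>p \<in> P\<close> \<open>s \<in> S\<close> \<open>a p s \<noteq> 0\<close> in auto)
  then show ?thesis by (rule minors_vanish_mono) auto
next
  case False
  then have PS: "a p t = 0" if "p \<in> P" "t \<in> S" for p t using that by blast
  with nz have "x \<in> Q \<or> x \<in> R" by blast
  then show ?thesis
  proof
    assume x: "x \<in> Q"
    have "a p y = 0" if "p \<in> P" "y \<in> R \<union> S" for p y
    proof -
      have "a p y * a x s = a p s * a x y" using X x nz(2) that unfolding minors_vanish_def by blast
      then show ?thesis using PS[OF that(1) nz(2)] nz(3) by simp
    qed
    moreover have "minors_vanish a P Q" using X' by (rule minors_vanish_mono) auto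
    ultimately show ?thesis using minors_vanish_add_zero_cols[of a P Q "R \<union> S"] by (simp add: Un_assoc)
  next
    assume x: "x \<in> R"
    have "a p y = 0" if "p \<in> P" "y \<in> Q \<union> S" for p y
    proof -
      have "a p y * a x s = a p s * a x y" using X' x nz(2) that unfolding minors_vanish_def by blast
      then show ?thesis using PS[OF that(1) nz(2)] nz(3) by simp
    qed
    moreover have "minors_vanish a P R" using X by (rule minors_vanish_mono) auto
    ultimately have "minors_vanish a P (R \<union> (Q \<union> S))" using minors_vanish_add_zero_cols by blast
    then show ?thesis by (rule minors_vanish_mono) auto
  qed
qed

lemma HL_corner:
  fixes A :: "'k::field mat"
  assumes A: "A \<in> carrier_mat n n" and irr: "irreducible_mat A"
    and XY: "{X,Y} \<in> HL_bipartitions A" and XY': "{X',Y'} \<in> HL_bipartitions A"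
    and ov: "overlap X Y X' Y'"
  shows "{X \<inter> X', Y \<union> Y'} \<in> HL_bipartitions A"
proof -
  let ?a = "\<lambda>i j. A $$ (i,j)"
  note h = XY[unfolded HL_bipartitions_iff[OF A]] and h' = XY'[unfolded HL_bipartitions_iff[OF A]]
  define P Q R S where PQRS: "P = X \<inter> X'" "Q = X \<inter> Y'" "R = Y \<inter> X'" "S = Y \<inter> Y'"
  have sets: "X = P \<union> Q" "Y = R \<union> S" "X' = P \<union> R" "Y' = Q \<union> S" "Y \<union> Y' = Q \<union> R \<union> S"
    using h h' unfolding PQRS by blast+
  have ne: "P \<noteq> {}" "S \<noteq> {}" using ov unfolding overlap_def PQRS by auto
  have parts: "P \<noteq> {}" "Q \<union> R \<union> S \<noteq> {}" "P \<inter> (Q \<union> R \<union> S) = {}" "P \<union> (Q \<union> R \<union> S) = {0..<n}"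
    using h h' ne unfolding PQRS by blast+
  have cut: "P \<union> Q \<union> R \<noteq> {} \<and> S \<noteq> {} \<and> (P \<union> Q \<union> R) \<inter> S = {} \<and> (P \<union> Q \<union> R) \<union> S = {0..<n}"
    using h h' ne unfolding PQRS by blast
  have cut': "S \<noteq> {} \<and> P \<union> Q \<union> R \<noteq> {} \<and> S \<inter> (P \<union> Q \<union> R) = {} \<and> S \<union> (P \<union> Q \<union> R) = {0..<n}"
    using cut by blast
  obtain x s where xs: "x \<in> P \<union> Q \<union> R" "s \<in> S" "?a x s \<noteq> 0"
    using irr[unfolded irreducible_mat_iff[OF A], rule_format, OF cut] by blast
  obtain y t where yt: "y \<in> P \<union> Q \<union> R" "t \<in> S" "?a t y \<noteq> 0"
    using irr[unfolded irreducible_mat_iff[OF A], rule_format, OF cut'] by blast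
  have t: "minors_vanish (\<lambda>i j. ?a j i) Z W \<longleftrightarrow> minors_vanish ?a W Z" for Z W
    by (rule minors_vanish_transpose)
  have "minors_vanish ?a P (Q \<union> R \<union> S)"
    by (rule minors_vanish_corner[where a = ?a, OF _ _ xs]) (use h h' sets in auto)
  moreover have "minors_vanish (\<lambda>i j. ?a j i) P (Q \<union> R \<union> S)"
    by (rule minors_vanish_corner[where a = "\<lambda>i j. ?a j i", OF _ _ yt]) (use h h' sets yt in \<open>simp_all only: t\<close>)
  ultimately show ?thesis
    unfolding HL_bipartitions_iff[OF A] t PQRS(1)[symmetric] sets(5)
    using parts by blast
qed

text \<open>
  Minors with two rows or two columns in one block are handled by that block's corner. For one
  index in each block, the products $a_{pq} a_{rs}$ and $a_{pr} a_{qs}$ both equal $a_{ps}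
  a_{qr}$, by one given cut each; symmetry is what makes these equations composable.
\<close>
lemma minors_vanish_diagonal:
  assumes sym: "\<And>x y. a x y = a y x"
    and X: "minors_vanish a (P \<union> Q) (R \<union> S)" and X': "minors_vanish a (P \<union> R) (Q \<union> S)"
    and P: "minors_vanish a P (Q \<union> R \<union> S)" and Q: "minors_vanish a Q (P \<union> R \<union> S)"
    and R: "minors_vanish a R (P \<union> Q \<union> S)" and S: "minors_vanish a S (P \<union> Q \<union> R)"
  shows "minors_vanish a (P \<union> S) (Q \<union> R)"
proof -
  have Qt: "minors_vanish a (P \<union> R \<union> S) Q" and Rt: "minors_vanish a (P \<union> Q \<union> S) R"
    using Q R sym unfolding minors_vanish_def by (metis mult.commute)+
  have cross: "a p q * a s r = a p r * a s q"
    if "p \<in> P" "q \<in> Q" "r \<in> R" "s \<in> S" for p q r s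
  proof -
    have "a p q * a r s = a p s * a r q" using X' that unfolding minors_vanish_def by blast
    moreover have "a p r * a q s = a p s * a q r" using X that unfolding minors_vanish_def by blast
    ultimately show ?thesis using sym by simp
  qed
  show ?thesis unfolding minors_vanish_def
  proof (intro ballI)
    fix x x' y y' assume h: "x \<in> P \<union> S" "x' \<in> P \<union> S" "y \<in> Q \<union> R" "y' \<in> Q \<union> R"
    consider "x \<in> P" "x' \<in> P" | "x \<in> S" "x' \<in> S" | "y \<in> Q" "y' \<in> Q" | "y \<in> R" "y' \<in> R"
      | "x \<in> P" "x' \<in> S" "y \<in> Q" "y' \<in> R" | "x \<in> P" "x' \<in> S" "y \<in> R" "y' \<in> Q"
      | "x \<in> S" "x' \<in> P" "y \<in> Q" "y' \<in> R" | "x \<in> S" "x' \<in> P" "y \<in> R" "y' \<in> Q"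
      using h by blast
    then show "a x y * a x' y' = a x y' * a x' y"
    proof cases
      case 1 then show ?thesis using P h unfolding minors_vanish_def by blast
    next
      case 2 then show ?thesis using S h unfolding minors_vanish_def by blast
    next
      case 3 then show ?thesis using Qt h unfolding minors_vanish_def by blast
    next
      case 4 then show ?thesis using Rt h unfolding minors_vanish_def by blast
    next
      case 5 then show ?thesis using cross[of x y y' x'] by simp
    next
      case 6 then show ?thesis using cross[of x y' y x'] by simp
    next
      case 7 then show ?thesis using cross[of x' y y' x] by (simp add: mult.commute)
    next
      case 8 then show ?thesis using cross[of x' y' y x] by (simp add: mult.commute)
    qed
  qed
qed

text \<open>
  (Q2) is the corner property applied to the four namings of the parts; (Q3) feeds the four
  resulting corners into the diagonal identity.
\<close>
lemma symmetric_HL_bipartitive: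
  fixes A :: "'k::field mat"
  assumes A: "A \<in> carrier_mat n n" and n: "n \<ge> 2"
    and symm: "transpose_mat A = A" and irr: "irreducible_mat A"
  shows "bipartitive {0..<n} (HL_bipartitions A)"
  unfolding bipartitive_def weakly_bipartitive_def
proof (intro conjI allI impI ballI)
  fix P assume "P \<in> HL_bipartitions A"
  then show "bipartition {0..<n} P" using A unfolding HL_bipartitions_def by auto
next
  fix v assume v: "v \<in> {0..<n}"
  have "(if v = 0 then 1 else 0) \<in> {0..<n} - {v}" using n by auto
  then have "{0..<n} - {v} \<noteq> {}" by blast
  then show "{{v}, {0..<n} - {v}} \<in> HL_bipartitions A"
    unfolding HL_bipartitions_iff[OF A] using v by (auto simp: minors_vanish_def)
next
  fix X Y X' Y'
  assume h: "{X,Y} \<in> HL_bipartitions A \<and> {X',Y'} \<in> HL_bipartitions A \<and> overlap X Y X' Y'"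
  then have e: "{X,Y} \<in> HL_bipartitions A" "{Y,X} \<in> HL_bipartitions A"
      "{X',Y'} \<in> HL_bipartitions A" "{Y',X'} \<in> HL_bipartitions A"
    by (simp_all add: insert_commute)
  have o: "overlap X Y X' Y'" "overlap X Y Y' X'" "overlap Y X X' Y'" "overlap Y X Y' X'"
    using h by (auto simp: overlap_def)
  note corner = HL_corner[OF A irr]
  show c1: "{X \<inter> X', Y \<union> Y'} \<in> HL_bipartitions A" by (rule corner[OF e(1) e(3) o(1)])
  show c2: "{X \<inter> Y', Y \<union> X'} \<in> HL_bipartitions A" by (rule corner[OF e(1) e(4) o(2)])
  show c3: "{Y \<inter> X', X \<union> Y'} \<in> HL_bipartitions A" by (rule corner[OF e(2) e(3) o(3)])
  show c4: "{Y \<inter> Y', X \<union> X'} \<in> HL_bipartitions A" by (rule corner[OF e(2) e(4) o(4)])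
next
  fix X Y X' Y'
  assume h: "{X,Y} \<in> HL_bipartitions A \<and> {X',Y'} \<in> HL_bipartitions A \<and> overlap X Y X' Y'"
  then have e: "{X,Y} \<in> HL_bipartitions A" "{Y,X} \<in> HL_bipartitions A"
      "{X',Y'} \<in> HL_bipartitions A" "{Y',X'} \<in> HL_bipartitions A"
    by (simp_all add: insert_commute)
  have o: "overlap X Y X' Y'" "overlap X Y Y' X'" "overlap Y X X' Y'" "overlap Y X Y' X'"
    using h by (auto simp: overlap_def)
  note corner = HL_corner[OF A irr]
  note c1 = corner[OF e(1) e(3) o(1), unfolded HL_bipartitions_iff[OF A]]
  note c2 = corner[OF e(1) e(4) o(2), unfolded HL_bipartitions_iff[OF A]]
  note c3 = corner[OF e(2) e(3) o(3), unfolded HL_bipartitions_iff[OF A]]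
  note c4 = corner[OF e(2) e(4) o(4), unfolded HL_bipartitions_iff[OF A]]
  note b = e(1)[unfolded HL_bipartitions_iff[OF A]] and b' = e(3)[unfolded HL_bipartitions_iff[OF A]]
  \<comment> \<open>Extending the entries by zero makes symmetry hold for all pairs of indices.\<close>
  define a where "a = (\<lambda>i j. if i < n \<and> j < n then A $$ (i,j) else 0)"
  have a_sym: "a i j = a j i" for i j
  proof (cases "i < n \<and> j < n")
    case True
    then have "A $$ (i,j) = transpose_mat A $$ (i,j)" using symm by simp
    then show ?thesis using True A by (simp add: a_def)
  qed (auto simp: a_def)
  have a: "minors_vanish (\<lambda>i j. A $$ (i,j)) Z W \<longleftrightarrow> minors_vanish a Z W"
    if "Z \<subseteq> {0..<n}" "W \<subseteq> {0..<n}" for Z W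
  proof -
    have "A $$ (i,j) = a i j" if "i \<in> Z" "j \<in> W" for i j
      using that \<open>Z \<subseteq> {0..<n}\<close> \<open>W \<subseteq> {0..<n}\<close> unfolding a_def by fastforce
    then show ?thesis unfolding minors_vanish_def by simp
  qed
  define P Q R S where PQRS: "P = X \<inter> X'" "Q = X \<inter> Y'" "R = Y \<inter> X'" "S = Y \<inter> Y'"
  have sets: "X = P \<union> Q" "Y = R \<union> S" "X' = P \<union> R" "Y' = Q \<union> S" "Y \<union> Y' = Q \<union> R \<union> S"
      "Y \<union> X' = P \<union> R \<union> S" "X \<union> Y' = P \<union> Q \<union> S" "X \<union> X' = P \<union> Q \<union> R"
      "sym_diff X X' = Q \<union> R" "sym_diff X Y' = P \<union> S" "P \<union> Q \<union> R \<union> S = {0..<n}"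
      "(Q \<union> R) \<inter> (P \<union> S) = {}"
    using b b' unfolding PQRS by blast+
  have ne: "P \<noteq> {}" "Q \<noteq> {}" using h unfolding overlap_def PQRS by auto
  have subs: "P \<subseteq> {0..<n}" "Q \<subseteq> {0..<n}" "R \<subseteq> {0..<n}" "S \<subseteq> {0..<n}" using sets(11) by blast+
  have "minors_vanish a (P \<union> S) (Q \<union> R)"
  proof (rule minors_vanish_diagonal[OF a_sym])
    show "minors_vanish a (P \<union> Q) (R \<union> S)" using b a[of "P \<union> Q" "R \<union> S"] subs unfolding sets(1,2) by simp
    show "minors_vanish a (P \<union> R) (Q \<union> S)" using b' a[of "P \<union> R" "Q \<union> S"] subs unfolding sets(3,4) by simp
    show "minors_vanish a P (Q \<union> R \<union> S)"
      using c1 a[of P "Q \<union> R \<union> S"] subs unfolding PQRS[symmetric] sets(5) by simp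
    show "minors_vanish a Q (P \<union> R \<union> S)"
      using c2 a[of Q "P \<union> R \<union> S"] subs unfolding PQRS[symmetric] sets(6) by simp
    show "minors_vanish a R (P \<union> Q \<union> S)"
      using c3 a[of R "P \<union> Q \<union> S"] subs unfolding PQRS[symmetric] sets(7) by simp
    show "minors_vanish a S (P \<union> Q \<union> R)"
      using c4 a[of S "P \<union> Q \<union> R"] subs unfolding PQRS[symmetric] sets(8) by simp
  qed
  moreover from this have "minors_vanish a (Q \<union> R) (P \<union> S)"
    unfolding minors_vanish_def by (metis a_sym mult.commute)
  ultimately show "{sym_diff X X', sym_diff X Y'} \<in> HL_bipartitions A"
    unfolding HL_bipartitions_iff[OF A] sets(9,10)
    using ne sets(11,12) a[of "P \<union> S" "Q \<union> R"] a[of "Q \<union> R" "P \<union> S"] subs by auto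
qed

section \<open>Weakly partitive families and modules\<close>

definition crossing :: "'a set \<Rightarrow> 'a set \<Rightarrow> bool" where
  "crossing X Y \<longleftrightarrow> X \<inter> Y \<noteq> {} \<and> X - Y \<noteq> {} \<and> Y - X \<noteq> {}"

definition weakly_partitive :: "'a set \<Rightarrow> 'a set set \<Rightarrow> bool" where
  "weakly_partitive U W \<longleftrightarrow>
     (\<forall>X\<in>W. X \<noteq> {} \<and> X \<subseteq> U) \<and> U \<in> W \<and> (\<forall>x\<in>U. {x} \<in> W) \<and>
     (\<forall>X\<in>W. \<forall>Y\<in>W. crossing X Y \<longrightarrow> X \<inter> Y \<in> W \<and> X \<union> Y \<in> W \<and> X - Y \<in> W)"

definition partitive :: "'a set \<Rightarrow> 'a set set \<Rightarrow> bool" where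
  "partitive U W \<longleftrightarrow> weakly_partitive U W \<and>
     (\<forall>X\<in>W. \<forall>Y\<in>W. crossing X Y \<longrightarrow> sym_diff X Y \<in> W)"

definition strong :: "'a set set \<Rightarrow> 'a set \<Rightarrow> bool" where
  "strong W Z \<longleftrightarrow> Z \<in> W \<and> (\<forall>X\<in>W. \<not> crossing X Z)"

definition modules :: "'a set \<Rightarrow> ('a \<Rightarrow> 'a \<Rightarrow> real) \<Rightarrow> 'a set set" where
  "modules U a = {M. M \<noteq> {} \<and> M \<subseteq> U \<and>
     (\<forall>x\<in>M. \<forall>x'\<in>M. \<forall>y\<in>U - M. a x y = a x' y \<and> a y x = a y x')}"

definition nonempty_subsets :: "'a set \<Rightarrow> 'a set set" where
  "nonempty_subsets U = {X. X \<noteq> {} \<and> X \<subseteq> U}"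

definition intervals :: "'a set \<Rightarrow> ('a \<Rightarrow> int) \<Rightarrow> 'a set set" where
  "intervals U f = {X. X \<noteq> {} \<and> X \<subseteq> U \<and>
     (\<forall>x\<in>X. \<forall>y\<in>X. \<forall>u\<in>U. f x < f u \<and> f u < f y \<longrightarrow> u \<in> X)}"

lemma crossing_commute: "crossing X Y \<longleftrightarrow> crossing Y X"
  by (auto simp: crossing_def)

lemma weakly_partitiveD:
  assumes "weakly_partitive U W"
  shows "X \<in> W \<Longrightarrow> X \<noteq> {}" "X \<in> W \<Longrightarrow> X \<subseteq> U" "U \<in> W" "x \<in> U \<Longrightarrow> {x} \<in> W"
    "X \<in> W \<Longrightarrow> Y \<in> W \<Longrightarrow> crossing X Y \<Longrightarrow> X \<inter> Y \<in> W"
    "X \<in> W \<Longrightarrow> Y \<in> W \<Longrightarrow> crossing X Y \<Longrightarrow> X \<union> Y \<in> W"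
    "X \<in> W \<Longrightarrow> Y \<in> W \<Longrightarrow> crossing X Y \<Longrightarrow> X - Y \<in> W"
  using assms unfolding weakly_partitive_def by blast+

lemma weakly_partitive_restrict:
  "weakly_partitive U W \<Longrightarrow> Z \<in> W \<Longrightarrow> weakly_partitive Z {X\<in>W. X \<subseteq> Z}"
  unfolding weakly_partitive_def by (simp add: Int_lower1 subset_iff)

lemma partitive_restrict:
  "partitive U W \<Longrightarrow> Z \<in> W \<Longrightarrow> partitive Z {X\<in>W. X \<subseteq> Z}"
  unfolding partitive_def by (auto simp: weakly_partitive_restrict)

text \<open>
  Call $Z$ a cut if both $Z$ and its complement are members. If $X$ crosses a minimal cut $Z$,
  then $Z \setminus X$ would be a smaller cut: its complement is $X$ if $X$ contains the
  complement of $Z$, and otherwise the union of $X$ with the crossing set $U \setminus Z$.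
\<close>
lemma minimal_cut_strong:
  assumes W: "weakly_partitive U W" and Z: "Z \<in> W" "U - Z \<in> W"
    and min: "\<And>Y. Y \<in> W \<Longrightarrow> U - Y \<in> W \<Longrightarrow> \<not> Y \<subset> Z"
  shows "strong W Z"
  unfolding strong_def
proof (intro conjI ballI notI)
  fix X assume X: "X \<in> W" and c: "crossing X Z"
  have sub: "X \<subseteq> U" "Z \<subseteq> U" using weakly_partitiveD(2)[OF W] X Z by auto
  have c': "crossing Z X" using c crossing_commute by blast
  have ZX: "Z - X \<in> W" by (rule weakly_partitiveD(7)[OF W Z(1) X c'])
  have "U - (Z - X) \<in> W"
  proof (cases "U - Z \<subseteq> X")
    case True
    then have "U - (Z - X) = X" using sub by blast
    then show ?thesis using X by simp
  next
    case False
    then have "crossing X (U - Z)" using c sub unfolding crossing_def by blast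
    then have "X \<union> (U - Z) \<in> W" using weakly_partitiveD(6)[OF W X Z(2)] by blast
    moreover have "X \<union> (U - Z) = U - (Z - X)" using sub by blast
    ultimately show ?thesis by simp
  qed
  moreover have "Z - X \<subset> Z" using c unfolding crossing_def by blast
  ultimately show False using min ZX by blast
qed (rule Z)

section \<open>Adding an extreme point to a linear or complete family\<close>

text \<open>
  Initial segments are obtained as final segments for $-f$, which has the same intervals as $f$.
\<close>
definition final :: "'a set \<Rightarrow> ('a \<Rightarrow> int) \<Rightarrow> 'a set \<Rightarrow> bool" where
  "final R f T \<longleftrightarrow> T \<subseteq> R \<and> (\<forall>x\<in>T. \<forall>y\<in>R - T. f y < f x)"

lemma final_nested:
  assumes "final R f S" "final R f T"
  shows "S \<subseteq> T \<or> T \<subseteq> S"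
proof (rule ccontr)
  assume "\<not> ?thesis"
  then obtain s t where "s \<in> S - T" "t \<in> T - S" by blast
  then have "f s < f t" "f t < f s" using assms unfolding final_def by blast+
  then show False by simp
qed

lemma final_interval:
  assumes T: "final R f T" and ne: "T \<noteq> {}"
  shows "T \<in> intervals R f"
  unfolding intervals_def
proof (intro CollectI conjI ballI impI)
  show "T \<subseteq> R" using T unfolding final_def by blast
  fix x y u assume x: "x \<in> T" and u: "u \<in> R" and lt: "f x < f u \<and> f u < f y"
  show "u \<in> T"
  proof (rule ccontr)
    assume "u \<notin> T"
    then have "f u < f x" using T x u unfolding final_def by blast
    then show False using lt by simp
  qed
qed (rule ne)

lemma final_compl_interval:
  assumes T: "final R f T" and ne: "T \<noteq> R"
  shows "R - T \<in> intervals R f"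
  unfolding intervals_def
proof (intro CollectI conjI ballI impI)
  show "R - T \<noteq> {}" using T ne unfolding final_def by blast
  fix x y u assume y: "y \<in> R - T" and u: "u \<in> R" and lt: "f x < f u \<and> f u < f y"
  show "u \<in> R - T"
  proof (rule ccontr)
    assume "u \<notin> R - T"
    then have "f y < f u" using T y u unfolding final_def by blast
    then show False using lt by simp
  qed
qed blast

lemma intervals_uminus: "intervals U (\<lambda>x. - f x) = intervals U f"
  unfolding intervals_def by auto

lemma interval_cut_final:
  assumes inj: "inj_on f R" and T: "T \<in> intervals R f" "R - T \<in> intervals R f"
  shows "final R f T \<or> final R (\<lambda>x. - f x) T"
proof (rule ccontr)
  assume n: "\<not> ?thesis"
  have sub: "T \<subseteq> R" using T unfolding intervals_def by blast
  obtain x y where xy: "x \<in> T" "y \<in> R - T" "\<not> f y < f x" using n sub unfolding final_def by blast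
  obtain x' y' where xy': "x' \<in> T" "y' \<in> R - T" "\<not> f x' < f y'"
    using n sub unfolding final_def by auto
  have ne: "f u \<noteq> f v" if "u \<in> T" "v \<in> R - T" for u v
    using that inj_onD[OF inj] sub by blast
  have "f x < f y" using ne xy by force
  have "f y' < f x'" using ne xy' by force
  show False
  proof (cases "f x < f y'")
    case True
    then have "y' \<in> T" using T(1) xy(1) xy'(1,2) \<open>f y' < f x'\<close> unfolding intervals_def by blast
    then show False using xy'(2) by blast
  next
    case False
    then have "f y' < f x" using ne[OF xy(1) xy'(2)] by simp
    then have "x \<in> R - T" using T(2) xy(1,2) xy'(2) \<open>f x < f y\<close> sub unfolding intervals_def by blast
    then show False using xy(1) by blast
  qed
qed

text \<open>
  The situation in which a minimal cut is a singleton $\{z\}$: the family on $U$ is to be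
  recovered from its members inside $R = U \setminus \{z\}$ and from the sets $T \subseteq R$
  for which $T \cup \{z\}$ is a member.
\<close>
locale one_point_extension =
  fixes U :: "'a set" and W :: "'a set set" and z :: 'a and R :: "'a set"
  assumes W: "weakly_partitive U W" and z: "z \<in> U" and R_def: "R = U - {z}" and R: "R \<in> W"
    and fin: "finite U"
begin

lemma insert_member_cut:
  assumes "insert z T \<in> W" "T \<noteq> {}" "T \<subset> R"
  shows "T \<in> W" "R - T \<in> W"
proof -
  have c: "crossing R (insert z T)" using assms R_def unfolding crossing_def by blast
  have "R \<inter> insert z T = T" "R - insert z T = R - T" using assms(3) R_def by auto
  then show "T \<in> W" "R - T \<in> W"
    using weakly_partitiveD(5,7)[OF W R assms(1) c] by simp_all
qed

text \<open>
  One proper final segment $S$ with $S \cup \{z\}$ a member suffices for all of them: larger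
  ones are unions of $S \cup \{z\}$ with an interval, and smaller ones arise by subtracting the
  initial segment $R \setminus T$.
\<close>
lemma insert_final:
  assumes int: "{X\<in>W. X \<subseteq> R} = intervals R f"
    and S: "final R f S" "S \<noteq> {}" "S \<noteq> R" "insert z S \<in> W" and T: "final R f T"
  shows "insert z T \<in> W"
proof (cases "T = {} \<or> T = R \<or> T = S")
  case True
  moreover have "insert z R = U" using z R_def by auto
  ultimately show ?thesis using weakly_partitiveD(3,4)[OF W] z S(4) by auto
next
  case False
  have zR: "z \<notin> R" and sub: "S \<subseteq> R" "T \<subseteq> R" using R_def S(1) T unfolding final_def by auto
  consider "S \<subset> T" | "T \<subset> S" using final_nested[OF S(1) T] False by blast
  then show ?thesis
  proof cases
    case 1
    have "T \<in> W" using final_interval[OF T] int False by blast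
    moreover have "crossing (insert z S) T" using 1 S(2) sub zR unfolding crossing_def by blast
    ultimately have "insert z S \<union> T \<in> W" using weakly_partitiveD(6)[OF W S(4)] by blast
    moreover have "insert z S \<union> T = insert z T" using 1 by blast
    ultimately show ?thesis by simp
  next
    case 2
    have "R - T \<in> W" using final_compl_interval[OF T] int False by blast
    moreover have "crossing (insert z S) (R - T)"
      using 2 S(2,3) sub zR unfolding crossing_def by blast
    ultimately have "insert z S - (R - T) \<in> W" using weakly_partitiveD(7)[OF W S(4)] by blast
    moreover have "insert z S - (R - T) = insert z T" using 2 sub zR by blast
    ultimately show ?thesis by simp
  qed
qed

text \<open>
  If $z$ extends exactly the final segments, it is a new maximum of the order.
\<close>
lemma extend_top:
  assumes int: "{X\<in>W. X \<subseteq> R} = intervals R f" and inj: "inj_on f R"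
    and final: "\<And>T. T \<subseteq> R \<Longrightarrow> insert z T \<in> W \<longleftrightarrow> final R f T"
  shows "\<exists>g. inj_on g U \<and> W = intervals U g"
proof -
  obtain b where b: "\<And>x. x \<in> R \<Longrightarrow> f x < b"
    using finite_imageI[of R f] fin R_def bdd_above_finite[of "f ` R"]
    by (metis Diff_subset finite_subset imageI bdd_above.E zle_add1_eq_le)
  define g where "g = f(z := b)"
  have zR: "z \<notin> R" and U: "U = insert z R" using R_def z by auto
  have g: "g z = b" "\<And>x. x \<in> R \<Longrightarrow> g x = f x" using zR unfolding g_def by auto
  have "inj_on g U"
    unfolding U inj_on_def using g b inj_onD[OF inj] by (metis insertE less_irrefl)
  moreover have "X \<in> W \<longleftrightarrow> X \<in> intervals U g" for X
  proof (cases "z \<in> X \<and> X \<subseteq> U")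
    case True
    define T where "T = X - {z}"
    have T: "X = insert z T" "T \<subseteq> R" using True U unfolding T_def by auto
    have "insert z T \<in> intervals U g \<longleftrightarrow> final R f T"
    proof
      assume I: "insert z T \<in> intervals U g"
      show "final R f T" unfolding final_def
      proof (intro conjI ballI)
        fix x y assume x: "x \<in> T" and y: "y \<in> R - T"
        have "y \<notin> insert z T" "y \<in> U" using y zR U by auto
        then have "\<not> (g x < g y \<and> g y < g z)" using I x unfolding intervals_def by blast
        moreover have "g y < g z" using g b y by simp
        ultimately have "f y \<le> f x" using g x y T by auto
        moreover have "f x \<noteq> f y" using inj_onD[OF inj] x y T by blast
        ultimately show "f y < f x" by simp
      qed (rule T)
    next
      assume F: "final R f T"
      show "insert z T \<in> intervals U g" unfolding intervals_def
      proof (intro CollectI conjI ballI impI)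
        show "insert z T \<subseteq> U" using T U by blast
        fix x y u assume x: "x \<in> insert z T" and y: "y \<in> insert z T" and u: "u \<in> U"
          and lt: "g x < g u \<and> g u < g y"
        show "u \<in> insert z T"
        proof (rule ccontr)
          assume n: "u \<notin> insert z T"
          then have uR: "u \<in> R - T" using u U by blast
          then have "g u < b" using g b by simp
          then have "x \<in> T" using lt g x by auto
          then have "f u < f x" using F uR unfolding final_def by blast
          then show False using lt g \<open>x \<in> T\<close> uR T by auto
        qed
      qed simp
    qed
    then show ?thesis using final[OF T(2)] T(1) by simp
  next
    case False
    show ?thesis
    proof (cases "X \<subseteq> R \<and> X \<noteq> {}")
      case True
      have "X \<in> intervals U g \<longleftrightarrow> X \<in> intervals R f"
      proof -
        have "(\<forall>x\<in>X. \<forall>y\<in>X. \<forall>u\<in>U. g x < g u \<and> g u < g y \<longrightarrow> u \<in> X) \<longleftrightarrow>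
              (\<forall>x\<in>X. \<forall>y\<in>X. \<forall>u\<in>R. f x < f u \<and> f u < f y \<longrightarrow> u \<in> X)"
        proof (rule ball_cong[OF refl], rule ball_cong[OF refl])
          fix x y assume "x \<in> X" "y \<in> X"
          then have xy: "x \<in> R" "y \<in> R" using True by auto
          then have "\<not> g z < g y" using g b[of y] by simp
          then show "(\<forall>u\<in>U. g x < g u \<and> g u < g y \<longrightarrow> u \<in> X) \<longleftrightarrow>
              (\<forall>u\<in>R. f x < f u \<and> f u < f y \<longrightarrow> u \<in> X)"
            unfolding U using g(2) xy by simp
        qed
        moreover have "X \<subseteq> U" using True U by blast
        ultimately show ?thesis using True unfolding intervals_def by simp
      qed
      then show ?thesis using True int by blast
    next
      case F2: False
      then have "\<not> (X \<subseteq> U \<and> X \<noteq> {})" using False U by blast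
      then show ?thesis using weakly_partitiveD(1,2)[OF W] unfolding intervals_def by blast
    qed
  qed
  ultimately show ?thesis by blast
qed

text \<open>
  Unless $z$ becomes a new maximum, some proper initial segment extends by $z$ too, and then $z$
  is adjacent to both ends $lo$ and $hi$ of the order. This makes $\{lo, hi\}$ an interval, so
  $R$ has just these two elements and every subset of $U$ is a member.
\<close>
lemma extend_linear_at_final:
  assumes int: "{X\<in>W. X \<subseteq> R} = intervals R f" and inj: "inj_on f R"
    and S: "final R f S" "S \<noteq> {}" "S \<noteq> R" "insert z S \<in> W"
  shows "W = nonempty_subsets U \<or> (\<exists>g. inj_on g U \<and> W = intervals U g)"
proof (cases "\<forall>T\<subseteq>R. insert z T \<in> W \<longrightarrow> final R f T")
  case True
  then have "\<exists>g. inj_on g U \<and> W = intervals U g"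
    using insert_final[OF int S] by (intro extend_top[OF int inj]) blast
  then show ?thesis by blast
next
  case False
  then obtain T where T: "T \<subseteq> R" "insert z T \<in> W" "\<not> final R f T" by blast
  have Tn: "T \<noteq> {}" "T \<noteq> R" using T(3) unfolding final_def by auto
  have "T \<in> intervals R f" "R - T \<in> intervals R f"
    using insert_member_cut[OF T(2) Tn(1)] T(1) Tn int by auto
  then have T': "final R (\<lambda>x. - f x) T" using interval_cut_final[OF inj] T(3) by blast
  have int': "{X\<in>W. X \<subseteq> R} = intervals R (\<lambda>x. - f x)" using int intervals_uminus by metis
  have finR: "finite R" "R \<noteq> {}" using fin R_def T(1) Tn by auto
  obtain hi where hi: "hi \<in> R" "\<And>x. x \<in> R \<Longrightarrow> f x \<le> f hi"
  proof -
    have "Max (f ` R) \<in> f ` R" using finR by simp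
    then obtain m where "m \<in> R" "f m = Max (f ` R)" by force
    then show ?thesis using finR by (intro that[of m]) simp_all
  qed
  obtain lo where lo: "lo \<in> R" "\<And>x. x \<in> R \<Longrightarrow> f lo \<le> f x"
  proof -
    have "Min (f ` R) \<in> f ` R" using finR by simp
    then obtain m where "m \<in> R" "f m = Min (f ` R)" by force
    then show ?thesis using finR by (intro that[of m]) simp_all
  qed
  have zR: "z \<notin> R" and U: "U = insert z R" using R_def z by auto
  have lt: "f lo < f x" if "x \<in> R" "x \<noteq> lo" for x
    using lo that inj_onD[OF inj, of lo x] by fastforce
  have gt: "f x < f hi" if "x \<in> R" "x \<noteq> hi" for x
    using hi that inj_onD[OF inj, of hi x] by fastforce
  have "final R f {hi}" "final R (\<lambda>x. - f x) {lo}"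
    unfolding final_def using hi(1) lo(1) lt gt by auto
  then have zhi: "insert z {hi} \<in> W" and zlo: "insert z {lo} \<in> W"
    using insert_final[OF int S] insert_final[OF int' T' Tn T(2)] by blast+
  have lohi: "lo \<noteq> hi"
  proof
    assume e: "lo = hi"
    have "x = lo" if "x \<in> R" for x using lt[OF that] hi(2)[OF that] e by force
    then have "R = {lo}" using lo(1) by blast
    then show False using S(1-3) unfolding final_def by blast
  qed
  have "crossing (insert z {hi}) (insert z {lo})" using lohi zR hi(1) lo(1) unfolding crossing_def by auto
  then have u: "insert z {hi} \<union> insert z {lo} \<in> W" using weakly_partitiveD(6)[OF W zhi zlo] by blast
  have "R = {lo,hi}"
  proof (rule ccontr)
    assume n: "R \<noteq> {lo,hi}"
    then obtain m where m: "m \<in> R" "m \<noteq> lo" "m \<noteq> hi" using lo(1) hi(1) by blast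
    have "crossing R (insert z {hi} \<union> insert z {lo})"
      using m lo(1) zR unfolding crossing_def by blast
    then have "R \<inter> (insert z {hi} \<union> insert z {lo}) \<in> W" using weakly_partitiveD(5)[OF W R u] by blast
    moreover have "R \<inter> (insert z {hi} \<union> insert z {lo}) = {lo,hi}" using lo(1) hi(1) zR by auto
    ultimately have "{lo,hi} \<in> intervals R f" using int lo(1) hi(1) by auto
    then have "m \<in> {lo,hi}" using lt[OF m(1,2)] gt[OF m(1,3)] m(1) unfolding intervals_def by blast
    then show False using m by blast
  qed
  have "W = nonempty_subsets U"
  proof
    show "W \<subseteq> nonempty_subsets U" using weakly_partitiveD(1,2)[OF W] unfolding nonempty_subsets_def by blast
    show "nonempty_subsets U \<subseteq> W"
    proof
      fix X assume "X \<in> nonempty_subsets U"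
      then have X: "X \<noteq> {}" "X \<subseteq> {z,lo,hi}" using U \<open>R = {lo,hi}\<close> unfolding nonempty_subsets_def by auto
      have "X \<in> Pow {z,lo,hi}" using X by blast
      then have "X \<in> {{}, {hi}, {lo}, {lo,hi}, {z}, {z,hi}, {z,lo}, {z,lo,hi}}"
        by (auto simp: Pow_insert)
      moreover have "{hi} \<in> W" "{lo} \<in> W" "{z} \<in> W" "{z,lo,hi} \<in> W" "{lo,hi} \<in> W"
        using weakly_partitiveD(3,4)[OF W] U \<open>R = {lo,hi}\<close> R by auto
      ultimately show "X \<in> W" using X(1) zhi zlo by auto
    qed
  qed
  then show ?thesis by blast
qed

lemma extend_linear:
  assumes int: "{X\<in>W. X \<subseteq> R} = intervals R f" and inj: "inj_on f R"
    and S: "S \<noteq> {}" "S \<subset> R" "insert z S \<in> W"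
  shows "W = nonempty_subsets U \<or> (\<exists>g. inj_on g U \<and> W = intervals U g)"
proof -
  have "S \<in> intervals R f" "R - S \<in> intervals R f"
    using insert_member_cut[OF S(3,1,2)] S int by auto
  then consider "final R f S" | "final R (\<lambda>x. - f x) S" using interval_cut_final[OF inj] by blast
  then show ?thesis
  proof cases
    case 1 then show ?thesis using extend_linear_at_final[OF int inj 1 S(1) _ S(3)] S(2) by blast
  next
    case 2
    have "inj_on (\<lambda>x. - f x) R" using inj unfolding inj_on_def by simp
    then show ?thesis
      using extend_linear_at_final[of "\<lambda>x. - f x", OF _ _ 2 S(1) _ S(3)] S(2) int intervals_uminus[of R f] by blast
  qed
qed

text \<open>
  Since all nonempty subsets of $R$ are available, the sets $T$ for which $T \cup \{z\}$ is a
  member are closed upwards from nonempty sets (by unions) and, unless $T = R$, downwards (by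
  differences). Both closures together reach every $T$ from one proper nonempty $S$; passing
  from $\{x\}$ to $\{t\}$ goes through $\{x, t\}$, which has to be a proper subset of $R$.
\<close>
lemma extend_complete:
  assumes all: "{X\<in>W. X \<subseteq> R} = nonempty_subsets R" and card: "card R \<ge> 3"
    and S: "S \<noteq> {}" "S \<subset> R" "insert z S \<in> W"
  shows "W = nonempty_subsets U"
proof -
  have zR: "z \<notin> R" and U: "U = insert z R" using R_def z by auto
  have sub: "X \<in> W" if "X \<noteq> {}" "X \<subseteq> R" for X using that all unfolding nonempty_subsets_def by blast
  have up: "insert z T \<in> W" if A: "insert z A \<in> W" "A \<noteq> {}" "A \<subseteq> T" "T \<subseteq> R" for A T
  proof (cases "T = A")
    case False
    have "crossing (insert z A) T" using A False zR unfolding crossing_def by blast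
    then have "insert z A \<union> T \<in> W" using weakly_partitiveD(6)[OF W A(1)] sub[of T] A(2-4) by blast
    moreover have "insert z A \<union> T = insert z T" using A(3) by blast
    ultimately show ?thesis by simp
  qed (use A in simp)
  have down: "insert z T \<in> W" if A: "insert z A \<in> W" "A \<subset> R" "T \<subseteq> A" for A T
  proof (cases "T = A")
    case False
    have "crossing (insert z A) (R - T)" using A False zR unfolding crossing_def by blast
    moreover have "R - T \<in> W" using sub[of "R - T"] A by blast
    ultimately have "insert z A - (R - T) \<in> W" using weakly_partitiveD(7)[OF W A(1)] by blast
    moreover have "insert z A - (R - T) = insert z T" using A zR by blast
    ultimately show ?thesis by simp
  qed (use A in simp)
  obtain x where x: "x \<in> S" using S(1) by blast
  have zx: "insert z {x} \<in> W" using down[OF S(3,2)] x by blast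
  have single: "insert z {t} \<in> W" if t: "t \<in> R" for t
  proof -
    have "{x,t} \<subset> R"
    proof -
      have "card {x,t} \<le> 2" by (simp add: card_insert_if)
      then have "{x,t} \<noteq> R" using card by auto
      then show ?thesis using x S(2) t by blast
    qed
    moreover have "insert z {x,t} \<in> W" by (rule up[OF zx]) (use \<open>{x,t} \<subset> R\<close> in auto)
    ultimately show ?thesis using down by blast
  qed
  have "X \<in> W" if X: "X \<noteq> {}" "X \<subseteq> U" for X
  proof (cases "z \<in> X")
    case True
    have e: "X = insert z (X - {z})" and XR: "X - {z} \<subseteq> R" using True X U by auto
    show ?thesis
    proof (cases "X - {z} = {}")
      case True
      then have "X = {z}" using \<open>z \<in> X\<close> by blast
      then show ?thesis using weakly_partitiveD(4)[OF W z] by simp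
    next
      case False
      then obtain t where t: "t \<in> X - {z}" by blast
      have "insert z (X - {z}) \<in> W"
        by (rule up[OF single[of t]]) (use t XR in blast)+
      then show ?thesis using e by simp
    qed
  next
    case False
    then show ?thesis using sub X U by blast
  qed
  then show ?thesis using weakly_partitiveD(1,2)[OF W] unfolding nonempty_subsets_def by blast
qed

end

section \<open>Families without proper strong members\<close>

lemma two_element_intervals:
  assumes W: "weakly_partitive R W" and card: "card R = 2"
  shows "\<exists>f. inj_on f R \<and> W = intervals R f"
proof -
  obtain p q where pq: "R = {p,q}" "p \<noteq> q" using card card_2_iff by metis
  have sub: "X \<in> {{p},{q},{p,q}}" if "X \<noteq> {}" "X \<subseteq> R" for X
  proof -
    have "X \<in> Pow {p,q}" using that pq(1) by simp
    then show ?thesis using that(1) by (auto simp: Pow_insert)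
  qed
  have "{p} \<in> W" "{q} \<in> W" "{p,q} \<in> W" using weakly_partitiveD(3,4)[OF W] pq by auto
  then have "X \<in> W \<longleftrightarrow> X \<noteq> {} \<and> X \<subseteq> R" for X
    using sub[of X] weakly_partitiveD(1,2)[OF W, of X] by auto
  then have all: "W = nonempty_subsets R" unfolding nonempty_subsets_def by blast
  define f where "f = (\<lambda>x. if x = p then 0 else 1 :: int)"
  have f: "f p = 0" "f q = 1" using pq unfolding f_def by auto
  have "inj_on f R" unfolding pq(1) using f by auto
  moreover have "intervals R f = nonempty_subsets R"
  proof -
    have "\<not> (f x < f u \<and> f u < f y)" for x u y unfolding f_def by auto
    then show ?thesis unfolding intervals_def nonempty_subsets_def by blast
  qed
  ultimately show "\<exists>f. inj_on f R \<and> W = intervals R f" using all by blast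
qed

definition only_trivial :: "'a set \<Rightarrow> 'a set set \<Rightarrow> bool" where
  "only_trivial U W \<longleftrightarrow> (\<forall>X\<in>W. X = U \<or> (\<exists>x. X = {x}))"

text \<open>
  Induction on the ground set. In a nontrivial family a maximal nontrivial member $M$ is crossed
  by some $Y$; maximality gives $Y \cup M = U$, so $M$ is a cut. A minimal cut is strong, hence
  a singleton $\{z\}$ here. Removing $z$ does not create nontrivial strong members: if a member
  $Q$ containing $z$ crosses $T \subset R$, then $R \cap Q$ or $R \setminus Q$ crosses $T$ as
  well. So the induction hypothesis applies to $R$; and as $R$ itself is not strong, some proper
  part of it extends by $z$, which determines the whole family.
\<close>
lemma strong_free_trichotomy:
  assumes "finite U" "weakly_partitive U W" "only_trivial U {Z. strong W Z}"
  shows "only_trivial U W \<or> W = nonempty_subsets U \<or> (\<exists>f. inj_on f U \<and> W = intervals U f)"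
  using assms
proof (induction "card U" arbitrary: U W rule: less_induct)
  case less
  note fin = less.prems(1) and W = less.prems(2)
  have ns: "Z = U \<or> (\<exists>z. Z = {z})" if "strong W Z" for Z
    using less.prems(3) that unfolding only_trivial_def by blast
  show ?case
  proof (cases "only_trivial U W")
    case False
    define N where "N = {X\<in>W. X \<noteq> U \<and> (\<nexists>x. X = {x})}"
    have "N \<subseteq> Pow U" using weakly_partitiveD(2)[OF W] unfolding N_def by blast
    then have finN: "finite N" using fin finite_subset by blast
    have "N \<noteq> {}" using False unfolding only_trivial_def N_def by blast
    then obtain M where M: "M \<in> N" "\<And>X. X \<in> N \<Longrightarrow> M \<subseteq> X \<Longrightarrow> M = X"
      using finite_has_maximal[OF finN] by blast
    have MW: "M \<in> W" "M \<noteq> U" "\<nexists>x. M = {x}" using M(1) unfolding N_def by auto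
    then have "\<not> strong W M" using ns by blast
    then obtain Y where Y: "Y \<in> W" "crossing Y M" using MW(1) unfolding strong_def by blast
    have MY: "Y \<union> M \<in> W" using weakly_partitiveD(6)[OF W Y(1) MW(1) Y(2)] .
    have "Y \<union> M = U"
    proof (rule ccontr)
      assume "Y \<union> M \<noteq> U"
      moreover have "Y \<union> M \<noteq> {x}" for x
        using MW(3) weakly_partitiveD(1)[OF W MW(1)] by (metis Un_upper2 subset_singletonD)
      ultimately have "Y \<union> M \<in> N" using MY unfolding N_def by blast
      then have "M = Y \<union> M" using M(2) by blast
      then show False using Y(2) unfolding crossing_def by blast
    qed
    moreover have "Y - M \<in> W" using weakly_partitiveD(7)[OF W Y(1) MW(1) Y(2)] .
    moreover have "(Y \<union> M) - M = Y - M" by blast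
    ultimately have UM: "U - M \<in> W" by simp
    define C where "C = {X\<in>W. U - X \<in> W}"
    have "C \<subseteq> Pow U" using weakly_partitiveD(2)[OF W] unfolding C_def by blast
    then have finC: "finite C" using fin finite_subset by blast
    have "M \<in> C" using MW(1) UM unfolding C_def by blast
    then obtain Z where Z: "Z \<in> C" "\<And>X. X \<in> C \<Longrightarrow> X \<subseteq> Z \<Longrightarrow> Z = X"
      using finite_has_minimal[OF finC] by blast
    have ZW: "Z \<in> W" "U - Z \<in> W" using Z(1) unfolding C_def by auto
    have "strong W Z"
      by (rule minimal_cut_strong[OF W ZW]) (use Z(2) in \<open>auto simp: C_def\<close>)
    moreover have "Z \<noteq> U" using weakly_partitiveD(1)[OF W ZW(2)] by blast
    ultimately obtain z where Zz: "Z = {z}" using ns by blast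
    define R where "R = U - {z}"
    have RW: "R \<in> W" using ZW(2) Zz unfolding R_def by simp
    have zU: "z \<in> U" using weakly_partitiveD(2)[OF W ZW(1)] Zz by blast
    interpret one_point_extension U W z R
      by standard (use W zU RW fin in \<open>auto simp: R_def\<close>)
    have finR: "finite R" using fin unfolding R_def by simp
    have U: "U = insert z R" and zR: "z \<notin> R" using zU unfolding R_def by auto
    have cardU: "card U = Suc (card R)" unfolding U using zR finR by simp
    have card2: "card R \<ge> 2"
    proof -
      have "M \<subset> U" using MW weakly_partitiveD(2)[OF W MW(1)] by blast
      then have "card M < card U" using fin psubset_card_mono by blast
      moreover have "finite M" using \<open>M \<subset> U\<close> fin finite_subset by blast
      moreover have "card M \<noteq> 0" using \<open>finite M\<close> weakly_partitiveD(1)[OF W MW(1)] by simp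
      moreover have "card M \<noteq> 1" using MW(3) card_1_singletonE by metis
      ultimately show ?thesis using cardU by linarith
    qed
    have "\<nexists>x. R = {x}" using card2 by auto
    then have "\<not> strong W R" using ns U zR by blast
    then obtain Y where Y: "Y \<in> W" "crossing Y R" using RW unfolding strong_def by blast
    define S where "S = Y - {z}"
    have "Y \<subseteq> U" using weakly_partitiveD(2)[OF W Y(1)] .
    have S: "S \<noteq> {}" "S \<subset> R" "insert z S \<in> W"
    proof -
      have "z \<in> Y" using Y(2) \<open>Y \<subseteq> U\<close> U unfolding crossing_def by blast
      then show "insert z S \<in> W" using Y(1) unfolding S_def by (simp add: insert_absorb)
      show "S \<noteq> {}" "S \<subset> R" using Y(2) \<open>Y \<subseteq> U\<close> unfolding S_def R_def crossing_def by blast+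
    qed
    let ?V = "{X\<in>W. X \<subseteq> R}"
    have V: "weakly_partitive R ?V" by (rule weakly_partitive_restrict[OF W RW])
    have "only_trivial R {Z. strong ?V Z}"
      unfolding only_trivial_def
    proof (intro ballI, rule ccontr)
      fix T assume "T \<in> {Z. strong ?V Z}" and nt: "\<not> (T = R \<or> (\<exists>x. T = {x}))"
      then have T: "T \<in> W" "T \<subseteq> R" "\<And>X. X \<in> W \<Longrightarrow> X \<subseteq> R \<Longrightarrow> \<not> crossing X T"
        unfolding strong_def by auto
      have "T \<noteq> U" using T(2) U zR by blast
      then have "\<not> strong W T" using ns nt by blast
      then obtain Q where Q: "Q \<in> W" "crossing Q T" using T(1) unfolding strong_def by blast
      have QU: "Q \<subseteq> U" using weakly_partitiveD(2)[OF W Q(1)] .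
      have "z \<in> Q" using T(3)[OF Q(1)] Q(2) QU U by blast
      \<comment> \<open>The part of $Q$ inside $R$ does not cross $T$, so it lies in $T$; then $R - Q$ crosses $T$.\<close>
      have c: "crossing R Q" using Q(2) T(2) \<open>z \<in> Q\<close> zR unfolding crossing_def by blast
      have "R \<inter> Q \<in> W" "R - Q \<in> W"
        using weakly_partitiveD(5,7)[OF W RW Q(1) c] by auto
      then have n: "\<not> crossing (R \<inter> Q) T" "\<not> crossing (R - Q) T" using T(3) by blast+
      have "R \<inter> Q \<subseteq> T" using n(1) Q(2) T(2) unfolding crossing_def by blast
      then show False using n(2) Q(2) T(2) nt unfolding crossing_def by blast
    qed
    then have IH: "only_trivial R ?V \<or> ?V = nonempty_subsets R \<or> (\<exists>f. inj_on f R \<and> ?V = intervals R f)"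
      using less.hyps[OF _ finR V] cardU by simp
    show ?thesis
    proof (cases "card R = 2")
      case True
      then show ?thesis using two_element_intervals[OF V] extend_linear[OF _ _ S] by blast
    next
      case False
      then have card3: "card R \<ge> 3" using card2 by simp
      have "\<not> only_trivial R ?V"
      proof
        assume t: "only_trivial R ?V"
        have m: "S \<in> ?V" "R - S \<in> ?V" using insert_member_cut[OF S(3,1,2)] S(2) by auto
        have "S \<noteq> R" "R - S \<noteq> R" using S(1,2) by blast+
        then obtain s t where st: "S = {s}" "R - S = {t}"
          using t[unfolded only_trivial_def, rule_format, OF m(1)]
            t[unfolded only_trivial_def, rule_format, OF m(2)] by blast
        then have "R = {s,t}" using S(2) by blast
        moreover have "card {s,t} \<le> 2" by (simp add: card_insert_if)
        ultimately show False using card3 by simp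
      qed
      then show ?thesis
        using IH extend_linear[OF _ _ S] extend_complete[OF _ card3 S] by blast
    qed
  qed blast
qed

section \<open>Matrices for the trivial, complete and linear families\<close>

lemma modulesD:
  assumes "M \<in> modules U a"
  shows "M \<noteq> {}" "M \<subseteq> U"
    "\<lbrakk>x \<in> M; x' \<in> M; y \<in> U; y \<notin> M\<rbrakk> \<Longrightarrow> a x y = a x' y"
    "\<lbrakk>x \<in> M; x' \<in> M; y \<in> U; y \<notin> M\<rbrakk> \<Longrightarrow> a y x = a y x'"
  using assms unfolding modules_def by blast+

lemma modulesI:
  assumes "M \<noteq> {}" "M \<subseteq> U"
    "\<And>x x' y. \<lbrakk>x \<in> M; x' \<in> M; y \<in> U; y \<notin> M\<rbrakk> \<Longrightarrow> a x y = a x' y \<and> a y x = a y x'"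
  shows "M \<in> modules U a"
  unfolding modules_def
proof (intro CollectI conjI ballI)
  fix x x' y assume "x \<in> M" "x' \<in> M" "y \<in> U - M"
  then have "a x y = a x' y \<and> a y x = a y x'" by (intro assms(3)) auto
  then show "a x y = a x' y" "a y x = a y x'" by blast+
qed (fact assms(1,2))+

lemma modules_constant: "modules U (\<lambda>_ _. c) = nonempty_subsets U"
  unfolding modules_def nonempty_subsets_def by auto

lemma modules_linear:
  assumes inj: "inj_on f U"
  shows "modules U (\<lambda>x y. if f x < f y then 1 else - 1) = intervals U f"
proof -
  let ?a = "\<lambda>x y. if f x < f y then 1 else - 1 :: real"
  have key: "(\<forall>x\<in>M. \<forall>x'\<in>M. \<forall>y\<in>U - M. ?a x y = ?a x' y \<and> ?a y x = ?a y x') \<longleftrightarrow>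
      (\<forall>x\<in>M. \<forall>y\<in>M. \<forall>u\<in>U. f x < f u \<and> f u < f y \<longrightarrow> u \<in> M)" (is "?l \<longleftrightarrow> ?r") if sub: "M \<subseteq> U" for M
  proof
    assume l: ?l
    show ?r
    proof (intro ballI impI, rule ccontr)
      fix x y u assume h: "x \<in> M" "y \<in> M" "u \<in> U" "f x < f u \<and> f u < f y" "u \<notin> M"
      then have "?a x u = ?a y u" using l by blast
      then show False using h(4) by simp
    qed
  next
    assume r: ?r
    show ?l
    proof (intro ballI)
      fix x x' y assume h: "x \<in> M" "x' \<in> M" "y \<in> U - M"
      have ne: "f x \<noteq> f y" "f x' \<noteq> f y" using inj_onD[OF inj] h sub by blast+
      have "\<not> (f x < f y \<and> f y < f x')" "\<not> (f x' < f y \<and> f y < f x)" using r h by blast+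
      then have "f x < f y \<longleftrightarrow> f x' < f y" "f y < f x \<longleftrightarrow> f y < f x'" using ne by linarith+
      then show "?a x y = ?a x' y \<and> ?a y x = ?a y x'" by simp
    qed
  qed
  show ?thesis unfolding modules_def intervals_def
    by (intro Collect_cong conj_cong refl key)
qed

text \<open>
  If some nonempty subset of $U$ is not an interval, a point $u$ lies strictly between two
  others. The segments below and above $u$ cross, and their symmetric difference contains those
  two points but not $u$.
\<close>
lemma partitive_intervals:
  assumes p: "partitive U (intervals U f)"
  shows "intervals U f = nonempty_subsets U"
proof (rule ccontr)
  assume "\<not> ?thesis"
  then obtain X x y u where X: "X \<subseteq> U" "x \<in> X" "y \<in> X" "u \<in> U" "f x < f u" "f u < f y"
    unfolding intervals_def nonempty_subsets_def by blast
  let ?A = "{t\<in>U. f t \<le> f u}" and ?B = "{t\<in>U. f u \<le> f t}"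
  have "?A \<in> intervals U f" "?B \<in> intervals U f" using X(4) unfolding intervals_def by auto
  moreover have "crossing ?A ?B"
  proof -
    have "u \<in> ?A \<inter> ?B" "x \<in> ?A - ?B" "y \<in> ?B - ?A" using X by auto
    then show ?thesis unfolding crossing_def by blast
  qed
  ultimately have "sym_diff ?A ?B \<in> intervals U f" using p unfolding partitive_def by blast
  moreover have "x \<in> sym_diff ?A ?B" "y \<in> sym_diff ?A ?B" using X by auto
  ultimately have "u \<in> sym_diff ?A ?B" using X(4-6) unfolding intervals_def by blast
  then show False by simp
qed

text \<open>
  A path on $0, 1, 2, \dots$ whose first edge carries the value $-1$. The special edge breaks
  the symmetry that would make the two ends of a path on three vertices a module, so that a
  single formula serves every length.
\<close>
definition pointed_path :: "nat \<Rightarrow> nat \<Rightarrow> real" where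
  "pointed_path i j = (if i = 0 \<and> j = 1 \<or> i = 1 \<and> j = 0 then - 1
     else if j = Suc i \<or> i = Suc j then 1 else 0)"

text \<open>
  Two consecutive vertices of a module propagate it in both directions along the path, since the
  next vertex is adjacent to just one of the two. If no two are consecutive, the vertex after
  $i$ lies outside the module and forces $j = i + 2$; then the vertex before $i$, or the special
  edge if $i = 0$, distinguishes $i$ from $j$.
\<close>
lemma pointed_path_prime:
  assumes M: "M \<in> modules {..<k} pointed_path" and ij: "i \<in> M" "j \<in> M" "i < j"
  shows "M = {..<k}"
proof -
  have sub: "M \<subseteq> {..<k}" using modulesD(2)[OF M] .
  have same: "pointed_path x y = pointed_path x' y" if "x \<in> M" "x' \<in> M" "y < k" "y \<notin> M" for x x' y
    using modulesD(3)[OF M that(1,2)] that(3,4) by simp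
  have adj: "pointed_path x y \<noteq> 0 \<longleftrightarrow> y = Suc x \<or> x = Suc y" for x y
    unfolding pointed_path_def by auto
  have "\<exists>m. m \<in> M \<and> Suc m \<in> M"
  proof (rule ccontr)
    assume no: "\<not> ?thesis"
    then have "Suc i \<noteq> j" using ij by blast
    then have si: "Suc i < j" "Suc i < k" "Suc i \<notin> M" using ij sub no by auto
    have "pointed_path j (Suc i) \<noteq> 0"
      using same[OF ij(1,2) si(2,3)] adj[of i "Suc i"] by simp
    then have j: "j = Suc (Suc i)" using adj[of j "Suc i"] si(1) by simp
    show False
    proof (cases i)
      case 0
      then show False using same[OF ij(1,2) si(2,3)] j unfolding pointed_path_def by simp
    next
      case (Suc m)
      then have "m \<notin> M" "m < k" using no ij sub by auto
      then have "pointed_path j m \<noteq> 0" using same[OF ij(1,2)] adj[of i m] Suc by auto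
      then show False using adj[of j m] j Suc by simp
    qed
  qed
  then obtain m where m: "m \<in> M" "Suc m \<in> M" by blast
  have up: "n \<in> M \<and> (Suc n < k \<longrightarrow> Suc n \<in> M)" if "m \<le> n" "n < k" for n
    using that
  proof (induction n rule: dec_induct)
    case base then show ?case using m by simp
  next
    case (step n)
    then have h: "n \<in> M" "Suc n \<in> M" by auto
    show ?case
    proof (intro conjI impI)
      assume "Suc (Suc n) < k"
      then show "Suc (Suc n) \<in> M"
        using same[OF h, of "Suc (Suc n)"] adj[of n "Suc (Suc n)"] adj[of "Suc n" "Suc (Suc n)"] by auto
    qed (rule h)
  qed
  have down: "n \<in> M \<and> Suc n \<in> M" if "n \<le> m" for n
    using that
  proof (induction n rule: inc_induct)
    case base then show ?case using m by simp
  next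
    case (step n)
    then have h: "Suc n \<in> M" "Suc (Suc n) \<in> M" by auto
    have "n < k" using h(1) sub by auto
    then show ?case
      using same[OF h, of n] adj[of "Suc n" n] adj[of "Suc (Suc n)" n] h(1) by auto
  qed
  show ?thesis using sub up down by (metis lessThan_iff linear subsetI subset_antisym)
qed

lemma modules_relabel:
  assumes e: "bij_betw e U V" and M: "M \<in> modules U (\<lambda>x y. a (e x) (e y))"
  shows "e ` M \<in> modules V a"
proof -
  have sub: "M \<subseteq> U" "M \<noteq> {}" using M unfolding modules_def by auto
  have im: "e ` U = V" using e by (simp add: bij_betw_def)
  show ?thesis
  proof (rule modulesI)
    show "e ` M \<noteq> {}" "e ` M \<subseteq> V" using sub im by auto
    fix u u' v assume "u \<in> e ` M" "u' \<in> e ` M" "v \<in> V" "v \<notin> e ` M"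
    moreover from this obtain y where "y \<in> U" "y \<notin> M" "v = e y" using im by blast
    ultimately show "a u v = a u' v \<and> a v u = a v u'"
      using modulesD(3,4)[OF M] by blast
  qed
qed

lemma prime_representation:
  assumes fin: "finite U" and W: "weakly_partitive U W" and triv: "only_trivial U W"
  shows "\<exists>a. (\<forall>x y. a x y \<in> {-1,0,1::real}) \<and> (\<forall>x y. a x y = a y x) \<and> W = modules U a"
proof -
  obtain e where "bij_betw e U {0..<card U}" using ex_bij_betw_finite_nat[OF fin] by blast
  then have e: "bij_betw e U {..<card U}" by (simp add: lessThan_atLeast0)
  define a where "a = (\<lambda>x y. pointed_path (e x) (e y))"
  have "a x y \<in> {-1,0,1}" "a x y = a y x" for x y unfolding a_def pointed_path_def by auto
  moreover have "W = modules U a"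
  proof
    show "W \<subseteq> modules U a"
    proof
      fix X assume X: "X \<in> W"
      then have "X = U \<or> (\<exists>x. X = {x})" using triv unfolding only_trivial_def by blast
      then show "X \<in> modules U a" using weakly_partitiveD(1,2)[OF W X] unfolding modules_def by auto
    qed
    show "modules U a \<subseteq> W"
    proof
      fix M assume M: "M \<in> modules U a"
      then have sub: "M \<subseteq> U" "M \<noteq> {}" unfolding modules_def by auto
      show "M \<in> W"
      proof (cases "\<exists>x. M = {x}")
        case True
        then show ?thesis using sub weakly_partitiveD(4)[OF W] by auto
      next
        case False
        have eM: "e ` M \<in> modules {..<card U} pointed_path"
          using modules_relabel[OF e] M unfolding a_def by blast
        have inj: "inj_on e U" using e by (rule bij_betw_imp_inj_on)
        obtain x where x: "x \<in> M" using sub by blast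
        then obtain y where y: "y \<in> M" "x \<noteq> y" using False by blast
        have "e x \<noteq> e y" using inj_onD[OF inj, of x y] x y sub by blast
        then have "e ` M = {..<card U}"
          using pointed_path_prime[OF eM, of "e x" "e y"] pointed_path_prime[OF eM, of "e y" "e x"] x y
          by (meson imageI linorder_neqE_nat)
        then have "e ` M = e ` U" using e by (simp add: bij_betw_def)
        then have "M = U" using inj sub by (simp add: inj_on_image_eq_iff)
        then show ?thesis using weakly_partitiveD(3)[OF W] by simp
      qed
    qed
  qed
  ultimately show ?thesis by blast
qed

section \<open>Separating the colours of cuts and stars\<close>

text \<open>
  A pair of values that is constant between a set and its complement in $Z$: the values that the
  two sides of a module crossing $Z$ would have to show inside $Z$.
\<close>
definition cut_colour :: "'a set \<Rightarrow> ('a \<Rightarrow> 'a \<Rightarrow> real) \<Rightarrow> real \<Rightarrow> real \<Rightarrow> bool" where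
  "cut_colour Z b p q \<longleftrightarrow> (\<exists>S. S \<noteq> {} \<and> S \<subset> Z \<and> (\<forall>c\<in>S. \<forall>d\<in>Z - S. b d c = p \<and> b c d = q))"

text \<open>
  A pair of values joining $z$ to all other elements of some module containing it: the values
  that a module crossing $Z$ shows between $Z$, contracted to $z$, and its part outside $Z$.
\<close>
definition star_colour :: "'a set \<Rightarrow> ('a \<Rightarrow> 'a \<Rightarrow> real) \<Rightarrow> 'a \<Rightarrow> real \<Rightarrow> real \<Rightarrow> bool" where
  "star_colour U a z p q \<longleftrightarrow>
     (\<exists>X\<in>modules U a. z \<in> X \<and> X \<noteq> {z} \<and> (\<forall>x\<in>X - {z}. a z x = p \<and> a x z = q))"

text \<open>
  Two proper nonempty subsets of $Z$ always separate a common pair of elements: one element in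
  both sets and one in neither, or one in each difference. The values at that pair are those of
  either set, in the same orientation in the first case and in opposite orientations in the
  second.
\<close>
lemma cut_colour_unique:
  assumes "cut_colour Z b p q" "cut_colour Z b p' q'"
  shows "p' = p \<and> q' = q \<or> p' = q \<and> q' = p"
proof -
  obtain S where S: "S \<noteq> {}" "S \<subset> Z" and Sc: "\<And>c d. c \<in> S \<Longrightarrow> d \<in> Z - S \<Longrightarrow> b d c = p \<and> b c d = q"
    using assms(1) unfolding cut_colour_def by blast
  obtain T where T: "T \<noteq> {}" "T \<subset> Z" and Tc: "\<And>c d. c \<in> T \<Longrightarrow> d \<in> Z - T \<Longrightarrow> b d c = p' \<and> b c d = q'"
    using assms(2) unfolding cut_colour_def by blast
  consider "S \<inter> T \<noteq> {}" "S \<union> T \<noteq> Z" | "S - T \<noteq> {}" "T - S \<noteq> {}"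
    using S T by blast
  then show ?thesis
  proof cases
    case 1
    then obtain s t where "s \<in> S \<inter> T" "t \<in> Z - (S \<union> T)" using S T by blast
    then show ?thesis using Sc[of s t] Tc[of s t] by auto
  next
    case 2
    then obtain s t where "s \<in> S - T" "t \<in> T - S" by blast
    then show ?thesis using Sc[of s t] Tc[of t s] S T by auto
  qed
qed

text \<open>
  If $x \in X \setminus Y$ and $y \in Y \setminus X$ for modules $X$, $Y$ through $z$, the
  values between $x$ and $y$ are those between $z$ and $y$, because $X$ is a module, and those
  between $x$ and $z$, because $Y$ is one. These two readings have opposite orientations, which
  is why the colours may come out exchanged.
\<close>
lemma star_colour_unique:
  assumes "star_colour U a z p q" "star_colour U a z p' q'"
  shows "p' = p \<and> q' = q \<or> p' = q \<and> q' = p"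
proof -
  obtain X where X: "X \<in> modules U a" "z \<in> X" "X \<noteq> {z}"
    and Xc: "\<And>x. x \<in> X \<Longrightarrow> x \<noteq> z \<Longrightarrow> a z x = p \<and> a x z = q"
    using assms(1) unfolding star_colour_def by blast
  obtain Y where Y: "Y \<in> modules U a" "z \<in> Y" "Y \<noteq> {z}"
    and Yc: "\<And>x. x \<in> Y \<Longrightarrow> x \<noteq> z \<Longrightarrow> a z x = p' \<and> a x z = q'"
    using assms(2) unfolding star_colour_def by blast
  obtain x where x: "x \<in> X" "x \<noteq> z" using X by blast
  obtain y where y: "y \<in> Y" "y \<noteq> z" using Y by blast
  show ?thesis
  proof (cases "x \<in> Y \<or> y \<in> X")
    case True
    then show ?thesis using Xc[of x] Yc[of x] Xc[of y] Yc[of y] x y by auto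
  next
    case False
    have U: "x \<in> U" "y \<in> U" using x y modulesD(2)[OF X(1)] modulesD(2)[OF Y(1)] by auto
    have "a y x = a y z" "a x y = a z y"
      using modulesD(3,4)[OF X(1) x(1) X(2) U(2)] False by simp_all
    moreover have "a y x = a z x" "a x y = a x z"
      using modulesD(3,4)[OF Y(1) y(1) Y(2) U(1)] False by simp_all
    ultimately show ?thesis using Xc[OF x] Yc[OF y] by auto
  qed
qed

lemma modules_recolour:
  assumes "inj \<phi>"
  shows "modules U (\<lambda>x y. \<phi> (a x y)) = modules U a"
  unfolding modules_def inj_eq[OF assms] ..

text \<open>
  If $(p, q)$ is both a cut colour and a star colour, all cut colours and all star colours use
  the values $p$ and $q$ only. Exchanging $p$ in $b$ with a value different from both therefore
  removes the conflict, and it preserves modules and symmetry.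
\<close>
lemma recolour_to_avoid:
  fixes b :: "'a \<Rightarrow> 'a \<Rightarrow> real"
  assumes range: "\<And>x y. b x y \<in> {-1,0,1}"
  shows "\<exists>b'. (\<forall>x y. b' x y \<in> {-1,0,1}) \<and> modules Z b' = modules Z b \<and>
    ((\<forall>x y. b x y = b y x) \<longrightarrow> (\<forall>x y. b' x y = b' y x)) \<and>
    (\<forall>p q. \<not> (cut_colour Z b' p q \<and> star_colour U a z p q))"
proof (cases "\<exists>p q. cut_colour Z b p q \<and> star_colour U a z p q")
  case False
  then show ?thesis using range by (intro exI[of _ b]) blast
next
  case True
  then obtain p q where cut: "cut_colour Z b p q" and star: "star_colour U a z p q" by blast
  have "\<exists>c\<in>Z. \<exists>d\<in>Z. b d c = p" using cut unfolding cut_colour_def by blast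
  then have p: "p \<in> {-1,0,1}" using range by metis
  obtain r where r: "r \<in> {-1,0,1::real}" "r \<noteq> p" "r \<noteq> q"
  proof -
    have "\<not> {-1,0,1::real} \<subseteq> {p,q}"
    proof
      assume "{-1,0,1::real} \<subseteq> {p,q}"
      then have "card {-1,0,1::real} \<le> card {p,q}" by (intro card_mono) auto
      also have "\<dots> \<le> 2" by (simp add: card_insert_if)
      finally show False by simp
    qed
    then show ?thesis using that by blast
  qed
  define \<phi> where "\<phi> = (\<lambda>v. if v = p then r else if v = r then p else v)"
  have inj: "inj \<phi>" unfolding \<phi>_def inj_on_def using r by auto
  have inv: "\<phi> (\<phi> v) = v" for v unfolding \<phi>_def using r by auto
  define b' where "b' = (\<lambda>x y. \<phi> (b x y))"
  have "b' x y \<in> {-1,0,1}" for x y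
    unfolding b'_def \<phi>_def using range[of x y] p r(1) by auto
  moreover have "modules Z b' = modules Z b" unfolding b'_def by (rule modules_recolour[OF inj])
  moreover have "(\<forall>x y. b x y = b y x) \<longrightarrow> (\<forall>x y. b' x y = b' y x)" unfolding b'_def by metis
  moreover have "\<not> (cut_colour Z b' p' q' \<and> star_colour U a z p' q')" for p' q'
  proof
    assume h: "cut_colour Z b' p' q' \<and> star_colour U a z p' q'"
    have "cut_colour Z b (\<phi> p') (\<phi> q')"
    proof -
      obtain S where S: "S \<noteq> {}" "S \<subset> Z" "\<And>c d. c \<in> S \<Longrightarrow> d \<in> Z - S \<Longrightarrow> b' d c = p' \<and> b' c d = q'"
        using h unfolding cut_colour_def by blast
      have "b d c = \<phi> p' \<and> b c d = \<phi> q'" if "c \<in> S" "d \<in> Z - S" for c d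
        using S(3)[OF that] inv unfolding b'_def by metis
      then show ?thesis using S(1,2) unfolding cut_colour_def by blast
    qed
    then have "\<phi> p' = p \<and> \<phi> q' = q \<or> \<phi> p' = q \<and> \<phi> q' = p" by (rule cut_colour_unique[OF cut])
    moreover have "p' = p \<and> q' = q \<or> p' = q \<and> q' = p"
      using star_colour_unique[OF star] h by blast
    moreover have "\<phi> p = r" unfolding \<phi>_def by simp
    ultimately show False using r by metis
  qed
  ultimately show ?thesis by blast
qed

section \<open>Contracting a strong member\<close>

text \<open>
  Contraction of a strong member to one of its points: \<open>proj\<close> is the contracting
  map, \<open>lift\<close> its preimage operation, and members of the quotient are the sets
  whose preimage is a member.
\<close>
locale contraction =
  fixes U :: "'a set" and W :: "'a set set" and Z :: "'a set" and z0 :: 'a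
  assumes W: "weakly_partitive U W" and strong: "strong W Z" and z0: "z0 \<in> Z"
begin

definition proj :: "'a \<Rightarrow> 'a" where "proj x = (if x \<in> Z then z0 else x)"

definition quotient_set :: "'a set" where "quotient_set = insert z0 (U - Z)"

definition lift :: "'a set \<Rightarrow> 'a set" where "lift X = {x\<in>U. proj x \<in> X}"

definition quotient :: "'a set set" where
  "quotient = {X. X \<noteq> {} \<and> X \<subseteq> quotient_set \<and> lift X \<in> W}"

lemma Z_member: "Z \<in> W"
  using strong unfolding strong_def by blast

lemma Z_subset: "Z \<subseteq> U"
  using weakly_partitiveD(2)[OF W Z_member] .

lemma quotient_set_subset: "quotient_set \<subseteq> U"
  using z0 Z_subset unfolding quotient_set_def by blast

lemma proj_quotient: "x \<in> quotient_set \<Longrightarrow> proj x = x"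
  using z0 unfolding quotient_set_def proj_def by auto

lemma proj_in: "x \<in> U \<Longrightarrow> proj x \<in> quotient_set"
  unfolding quotient_set_def proj_def by auto

lemma lift_Int: "lift (X \<inter> Y) = lift X \<inter> lift Y"
  and lift_Un: "lift (X \<union> Y) = lift X \<union> lift Y"
  and lift_Diff: "lift (X - Y) = lift X - lift Y"
  unfolding lift_def by auto

lemma lift_nonempty: "X \<subseteq> quotient_set \<Longrightarrow> X \<noteq> {} \<Longrightarrow> lift X \<noteq> {}"
  using proj_quotient quotient_set_subset unfolding lift_def by fastforce

lemma crossing_lift:
  assumes "crossing X Y" "X \<subseteq> quotient_set" "Y \<subseteq> quotient_set"
  shows "crossing (lift X) (lift Y)"
proof -
  have "X \<inter> Y \<noteq> {}" "X - Y \<noteq> {}" "Y - X \<noteq> {}" using assms(1) unfolding crossing_def by auto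
  then show ?thesis unfolding crossing_def lift_Int[symmetric] lift_Diff[symmetric]
    using lift_nonempty assms(2,3) by (metis Diff_subset Int_lower1 order_trans)
qed

lemma quotient_weakly_partitive: "weakly_partitive quotient_set quotient"
  unfolding weakly_partitive_def
proof (intro conjI ballI impI)
  have "lift quotient_set = U" unfolding lift_def using proj_in by blast
  then show "quotient_set \<in> quotient"
    using weakly_partitiveD(3)[OF W] unfolding quotient_def quotient_set_def by simp
  fix x assume x: "x \<in> quotient_set"
  have "lift {x} = (if x = z0 then Z else {x})"
    using x z0 Z_subset unfolding lift_def proj_def quotient_set_def by auto
  then show "{x} \<in> quotient"
    using x Z_member weakly_partitiveD(4)[OF W, of x] quotient_set_subset unfolding quotient_def by auto
next
  fix X Y assume h: "X \<in> quotient" "Y \<in> quotient" "crossing X Y"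
  then have s: "X \<subseteq> quotient_set" "Y \<subseteq> quotient_set" and l: "lift X \<in> W" "lift Y \<in> W"
    unfolding quotient_def by auto
  note c = crossing_lift[OF h(3) s]
  have ne: "X \<inter> Y \<noteq> {}" "X \<union> Y \<noteq> {}" "X - Y \<noteq> {}" using h(3) unfolding crossing_def by auto
  show "X \<inter> Y \<in> quotient" "X \<union> Y \<in> quotient" "X - Y \<in> quotient"
    using weakly_partitiveD(5-7)[OF W l c] s ne
    unfolding quotient_def by (auto simp: lift_Int lift_Un lift_Diff)
qed (auto simp: quotient_def)

lemma quotient_partitive:
  assumes "partitive U W"
  shows "partitive quotient_set quotient"
  unfolding partitive_def
proof (intro conjI ballI impI)
  fix X Y assume h: "X \<in> quotient" "Y \<in> quotient" "crossing X Y"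
  then have s: "X \<subseteq> quotient_set" "Y \<subseteq> quotient_set" and l: "lift X \<in> W" "lift Y \<in> W"
    unfolding quotient_def by auto
  have "sym_diff (lift X) (lift Y) \<in> W"
    using assms crossing_lift[OF h(3) s] l unfolding partitive_def by blast
  moreover have "sym_diff X Y \<noteq> {}" using h(3) unfolding crossing_def by blast
  ultimately show "sym_diff X Y \<in> quotient"
    using s unfolding quotient_def by (auto simp: lift_Un lift_Diff)
qed (rule quotient_weakly_partitive)

definition glue :: "('a \<Rightarrow> 'a \<Rightarrow> real) \<Rightarrow> ('a \<Rightarrow> 'a \<Rightarrow> real) \<Rightarrow> 'a \<Rightarrow> 'a \<Rightarrow> real" where
  "glue a b x y = (if x \<in> Z \<and> y \<in> Z then b x y else a (proj x) (proj y))"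

lemma glue_simps:
  "x \<in> Z \<Longrightarrow> y \<in> Z \<Longrightarrow> glue a b x y = b x y"
  "x \<notin> Z \<Longrightarrow> y \<notin> Z \<Longrightarrow> glue a b x y = a x y"
  "x \<in> Z \<Longrightarrow> y \<notin> Z \<Longrightarrow> glue a b x y = a z0 y"
  "x \<notin> Z \<Longrightarrow> y \<in> Z \<Longrightarrow> glue a b x y = a x z0"
  unfolding glue_def proj_def by auto

text \<open>
  Members are modules because a strong $Z$ is either disjoint from a member, or contained in it,
  or contains it. Conversely, let a module $M$ cross $Z$. Any $d \in Z \setminus M$ sees $c \in
  M \cap Z$ as it sees $x \in M \setminus Z$, and $x$ sees all of $Z$ as the contracted point.
  So the values between $M \cap Z$ and $Z \setminus M$ form a cut colour of $b$ that is also a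
  star colour of $a$, as the image of $M$ is a module of $a$.
\<close>
lemma glue_represents:
  assumes b: "{X\<in>W. X \<subseteq> Z} = modules Z b" and a: "quotient = modules quotient_set a"
    and clash: "\<And>p q. \<not> (cut_colour Z b p q \<and> star_colour quotient_set a z0 p q)"
  shows "W = modules U (glue a b)"
proof
  show "W \<subseteq> modules U (glue a b)"
  proof
    fix X assume X: "X \<in> W"
    have ne: "X \<noteq> {}" "X \<subseteq> U" using weakly_partitiveD(1,2)[OF W X] by auto
    have "\<not> crossing X Z" using strong X unfolding strong_def by blast
    then consider "X \<subseteq> Z" | "X \<inter> Z = {} \<or> Z \<subseteq> X" unfolding crossing_def by blast
    then show "X \<in> modules U (glue a b)"
    proof cases
      case 1
      then have m: "X \<in> modules Z b" using X b by blast
      show ?thesis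
      proof (rule modulesI[OF ne])
        fix x x' y assume h: "x \<in> X" "x' \<in> X" "y \<in> U" "y \<notin> X"
        then have Zx: "x \<in> Z" "x' \<in> Z" using 1 by auto
        show "glue a b x y = glue a b x' y \<and> glue a b y x = glue a b y x'"
        proof (cases "y \<in> Z")
          case True
          then show ?thesis using Zx modulesD(3,4)[OF m h(1,2) True h(4)] by (simp add: glue_simps)
        next
          case False
          then show ?thesis using Zx by (simp add: glue_simps)
        qed
      qed
    next
      case 2
      let ?Y = "X \<inter> quotient_set"
      have pX: "proj x \<in> ?Y \<longleftrightarrow> x \<in> X" if "x \<in> U" for x
        using 2 that z0 proj_in[OF that] unfolding proj_def by auto
      then have "lift ?Y = X" using ne(2) unfolding lift_def by blast
      moreover have "?Y \<noteq> {}" using pX ne by blast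
      ultimately have "?Y \<in> quotient" using X unfolding quotient_def by simp
      then have m: "?Y \<in> modules quotient_set a" using a by simp
      show ?thesis
      proof (rule modulesI[OF ne])
        fix x x' y assume h: "x \<in> X" "x' \<in> X" "y \<in> U" "y \<notin> X"
        then have e: "glue a b u y = a (proj u) (proj y)" "glue a b y u = a (proj y) (proj u)"
          if "u \<in> X" for u
          using 2 that unfolding glue_def by auto
        have p: "proj x \<in> ?Y" "proj x' \<in> ?Y" "proj y \<in> quotient_set" "proj y \<notin> ?Y"
          using pX proj_in h ne(2) by blast+
        show "glue a b x y = glue a b x' y \<and> glue a b y x = glue a b y x'"
          unfolding e[OF h(1)] e[OF h(2)] using modulesD(3,4)[OF m p] by blast
      qed
    qed
  qed
next
  show "modules U (glue a b) \<subseteq> W"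
  proof
    fix M assume M: "M \<in> modules U (glue a b)"
    have ne: "M \<noteq> {}" "M \<subseteq> U" using modulesD(1,2)[OF M] .
    note MD = modulesD(3,4)[OF M]
    show "M \<in> W"
    proof (cases "M \<subseteq> Z")
      case True
      have "M \<in> modules Z b"
      proof (rule modulesI[OF ne(1) True])
        fix x x' y assume h: "x \<in> M" "x' \<in> M" "y \<in> Z" "y \<notin> M"
        then have "x \<in> Z" "x' \<in> Z" "y \<in> U" using True Z_subset by auto
        then show "b x y = b x' y \<and> b y x = b y x'"
          using MD[OF h(1,2) _ h(4)] h(3) by (simp add: glue_simps)
      qed
      then show ?thesis using b by blast
    next
      case out: False
      let ?Y = "proj ` M"
      have Ysub: "?Y \<subseteq> quotient_set" using proj_in ne(2) by blast
      have g: "glue a b x y = a (proj x) y" "glue a b y x = a y (proj x)" if "y \<notin> Z" for x y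
        using that unfolding glue_def proj_def by auto
      have Ymod: "?Y \<in> modules quotient_set a"
      proof (rule modulesI[OF _ Ysub])
        show "?Y \<noteq> {}" using ne by blast
        fix u u' y assume h: "u \<in> ?Y" "u' \<in> ?Y" "y \<in> quotient_set" "y \<notin> ?Y"
        obtain x x' where x: "x \<in> M" "u = proj x" "x' \<in> M" "u' = proj x'" using h by blast
        have y: "y \<in> U" "proj y = y" using h(3) quotient_set_subset proj_quotient by auto
        then have yM: "y \<notin> M" using h(4) by (metis imageI)
        show "a u y = a u' y \<and> a y u = a y u'"
        proof (cases "y \<in> Z")
          case False
          then show ?thesis using MD[OF x(1,3) y(1) yM] x g by simp
        next
          case True
          then have "y = z0" using y(2) unfolding proj_def by simp
          moreover have "y \<noteq> proj x" "y \<noteq> proj x'" using h(1,2,4) unfolding x(2,4)[symmetric] by metis+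
          ultimately have nZ: "x \<notin> Z" "x' \<notin> Z" unfolding proj_def by auto
          then have "glue a b v y = a (proj v) y" "glue a b y v = a y (proj v)" if "v \<in> {x,x'}" for v
            using that y(2) unfolding glue_def by auto
          then show ?thesis using MD[OF x(1,3) y(1) yM] x(2,4) by simp
        qed
      qed
      show ?thesis
      proof (cases "M \<inter> Z = {} \<or> Z \<subseteq> M")
        case True
        have "lift ?Y = M"
        proof
          show "M \<subseteq> lift ?Y" using ne(2) unfolding lift_def by blast
          show "lift ?Y \<subseteq> M"
          proof
            fix x assume "x \<in> lift ?Y"
            then obtain y where y: "x \<in> U" "y \<in> M" "proj x = proj y" unfolding lift_def by blast
            show "x \<in> M"
            proof (cases "x \<in> Z \<or> y \<in> Z")
              case True
              then have "x \<in> Z" "y \<in> Z" using y(3) z0 unfolding proj_def by (auto split: if_splits)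
              then show ?thesis using \<open>M \<inter> Z = {} \<or> Z \<subseteq> M\<close> y(2) by blast
            next
              case False
              then show ?thesis using y unfolding proj_def by simp
            qed
          qed
        qed
        moreover have "?Y \<in> quotient" using Ymod a by simp
        ultimately show ?thesis unfolding quotient_def by simp
      next
        case False
        obtain x0 where x0: "x0 \<in> M" "x0 \<notin> Z" using out by blast
        obtain c0 where c0: "c0 \<in> M" "c0 \<in> Z" using False by blast
        obtain d0 where d0: "d0 \<in> Z" "d0 \<notin> M" using False by blast
        have eq: "b d c = a z0 x \<and> b c d = a x z0"
          if "c \<in> M" "c \<in> Z" "d \<in> Z" "d \<notin> M" "x \<in> M" "x \<notin> Z" for c d x
          using MD[OF that(1,5) _ that(4)] that(2,3,6) Z_subset by (auto simp: glue_simps)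
        have "cut_colour Z b (a z0 x0) (a x0 z0)"
          unfolding cut_colour_def
          by (rule exI[of _ "M \<inter> Z"]) (use eq x0 c0 d0 in blast)
        moreover have "star_colour quotient_set a z0 (a z0 x0) (a x0 z0)"
          unfolding star_colour_def
        proof (intro bexI[OF _ Ymod] conjI ballI)
          show "z0 \<in> ?Y" using c0 unfolding proj_def by force
          have "proj x0 = x0" "x0 \<noteq> z0" using x0(2) z0 unfolding proj_def by auto
          then show "?Y \<noteq> {z0}" using x0(1) by (metis imageI singletonD)
          fix u assume "u \<in> ?Y - {z0}"
          then obtain x where x: "x \<in> M" "u = proj x" "u \<noteq> z0" by blast
          then have "x \<notin> Z" "u = x" unfolding proj_def by (auto split: if_splits)
          then show "a z0 u = a z0 x0" "a u z0 = a x0 z0"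
            using eq[OF c0 d0 x(1)] eq[OF c0 d0 x0] by auto
        qed
        ultimately show ?thesis using clash by blast
      qed
    qed
  qed
qed

end

section \<open>Every weakly partitive family is a family of modules\<close>

text \<open>
  A nontrivial strong member is smaller than the ground set, and contracting it makes the ground
  set smaller, so the induction hypothesis applies to both pieces. The asymmetric matrix of a
  linear order is only needed for families of intervals that miss some nonempty set, and these
  are never partitive.
\<close>
lemma weakly_partitive_representation:
  assumes "finite U" "weakly_partitive U W"
  shows "\<exists>a. (\<forall>x y. a x y \<in> {-1,0,1}) \<and> W = modules U a \<and>
    (partitive U W \<longrightarrow> (\<forall>x y. a x y = a y x))"
  using assms
proof (induction "card U" arbitrary: U W rule: less_induct)
  case less
  note fin = less.prems(1) and W = less.prems(2)
  show ?case
  proof (cases "only_trivial U {Z. strong W Z}")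
    case True
    then consider "only_trivial U W" | "W = nonempty_subsets U"
      | f where "inj_on f U" "W = intervals U f" "W \<noteq> nonempty_subsets U"
      using strong_free_trichotomy[OF fin W] by blast
    then show ?thesis
    proof cases
      case 1
      then show ?thesis using prime_representation[OF fin W] by blast
    next
      case 2
      then show ?thesis by (intro exI[of _ "\<lambda>_ _. 0"]) (simp add: modules_constant)
    next
      case (3 f)
      then have "\<not> partitive U W" using partitive_intervals by blast
      then show ?thesis using 3
        by (intro exI[of _ "\<lambda>x y. if f x < f y then 1 else - 1"]) (simp add: modules_linear)
    qed
  next
    case False
    then obtain Z where Z: "strong W Z" "Z \<noteq> U" "\<nexists>z. Z = {z}" unfolding only_trivial_def by blast
    have ZW: "Z \<in> W" using Z(1) unfolding strong_def by blast
    have sub: "Z \<noteq> {}" "Z \<subset> U" using weakly_partitiveD(1,2)[OF W ZW] Z(2) by auto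
    obtain z0 where z0: "z0 \<in> Z" using sub by blast
    interpret contraction U W Z z0 by standard (use W Z z0 in auto)
    obtain z1 where z1: "z1 \<in> Z" "z1 \<noteq> z0" using Z(3) z0 by blast
    have "quotient_set \<subset> U" using quotient_set_subset z1 sub(2) unfolding quotient_set_def by blast
    then have card: "card quotient_set < card U" "card Z < card U" and finq: "finite quotient_set" "finite Z"
      using sub(2) fin psubset_card_mono finite_subset by blast+
    obtain a where a: "\<forall>x y. a x y \<in> {-1,0,1}" "quotient = modules quotient_set a"
        "partitive quotient_set quotient \<longrightarrow> (\<forall>x y. a x y = a y x)"
      using less.hyps[OF card(1) finq(1) quotient_weakly_partitive] by blast
    obtain b0 where b0: "\<forall>x y. b0 x y \<in> {-1,0,1}" "{X\<in>W. X \<subseteq> Z} = modules Z b0"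
        "partitive Z {X\<in>W. X \<subseteq> Z} \<longrightarrow> (\<forall>x y. b0 x y = b0 y x)"
      using less.hyps[OF card(2) finq(2) weakly_partitive_restrict[OF W ZW]] by blast
    obtain b where b: "\<forall>x y. b x y \<in> {-1,0,1}" "modules Z b = modules Z b0"
        "(\<forall>x y. b0 x y = b0 y x) \<longrightarrow> (\<forall>x y. b x y = b y x)"
        "\<forall>p q. \<not> (cut_colour Z b p q \<and> star_colour quotient_set a z0 p q)"
      using recolour_to_avoid[of b0 Z quotient_set a z0] b0(1) by blast
    have "W = modules U (glue a b)"
      by (rule glue_represents) (use a(2) b0(2) b(2,4) in simp_all)
    moreover have "\<forall>x y. glue a b x y \<in> {-1,0,1}" using a(1) b(1) unfolding glue_def by simp
    moreover have "partitive U W \<longrightarrow> (\<forall>x y. glue a b x y = glue a b y x)"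
    proof (intro impI allI)
      fix x y assume p: "partitive U W"
      have "a u v = a v u" "b u v = b v u" for u v
        using a(3) b0(3) b(3) quotient_partitive[OF p] partitive_restrict[OF p ZW] by blast+
      then show "glue a b x y = glue a b y x" unfolding glue_def by (metis)
    qed
    ultimately show ?thesis by blast
  qed
qed

section \<open>Rooting a bipartitive family at a vertex\<close>

definition rooted :: "'a set \<Rightarrow> 'a set set set \<Rightarrow> 'a \<Rightarrow> 'a set set" where
  "rooted V F v = {X. X \<subseteq> V - {v} \<and> {X, V - X} \<in> F}"

text \<open>
  For parts avoiding $v$, the complements always meet in $v$, so crossing is the same as
  overlapping of the bipartitions.
\<close>
lemma rooted_crossing:
  assumes F: "weakly_bipartitive V F" and v: "v \<in> V"
    and X: "X \<in> rooted V F v" and Y: "Y \<in> rooted V F v" and c: "crossing X Y"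
  shows "overlap X (V - X) Y (V - Y)"
    and "X \<inter> Y \<in> rooted V F v" and "X \<union> Y \<in> rooted V F v" and "X - Y \<in> rooted V F v"
proof -
  have s: "X \<subseteq> V - {v}" "Y \<subseteq> V - {v}" and m: "{X, V - X} \<in> F" "{Y, V - Y} \<in> F"
    using X Y unfolding rooted_def by auto
  show o: "overlap X (V - X) Y (V - Y)"
    using c s v unfolding overlap_def crossing_def by blast
  have e: "(V - X) \<union> (V - Y) = V - X \<inter> Y" "(V - X) \<inter> (V - Y) = V - (X \<union> Y)"
      "X \<inter> (V - Y) = X - Y" "(V - X) \<union> Y = V - (X - Y)"
    using s by blast+
  have "\<forall>X Y X' Y'. {X, Y} \<in> F \<and> {X', Y'} \<in> F \<and> overlap X Y X' Y' \<longrightarrow>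
      {X \<inter> X', Y \<union> Y'} \<in> F \<and> {X \<inter> Y', Y \<union> X'} \<in> F \<and> {Y \<inter> X', X \<union> Y'} \<in> F \<and> {Y \<inter> Y', X \<union> X'} \<in> F"
    using F unfolding weakly_bipartitive_def by (elim conjE)
  from this[rule_format, OF conjI, OF m(1) conjI, OF m(2) o]
  have "{X \<inter> Y, V - X \<inter> Y} \<in> F" "{X \<union> Y, V - (X \<union> Y)} \<in> F" "{X - Y, V - (X - Y)} \<in> F"
    unfolding e by (simp_all add: insert_commute)
  then show "X \<inter> Y \<in> rooted V F v" "X \<union> Y \<in> rooted V F v" "X - Y \<in> rooted V F v"
    using s unfolding rooted_def by auto
qed

lemma rooted_weakly_partitive:
  assumes F: "weakly_bipartitive V F" and v: "v \<in> V" "V \<noteq> {v}"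
  shows "weakly_partitive (V - {v}) (rooted V F v)"
  unfolding weakly_partitive_def
proof (intro conjI ballI impI)
  have trivial: "{{x}, V - {x}} \<in> F" if "x \<in> V" for x
    using F that unfolding weakly_bipartitive_def by blast
  have "V - (V - {v}) = {v}" using v by blast
  then show "V - {v} \<in> rooted V F v"
    using trivial[OF v(1)] unfolding rooted_def by (simp add: insert_commute)
  show "{x} \<in> rooted V F v" if "x \<in> V - {v}" for x
    using trivial[of x] that unfolding rooted_def by simp
  show "X \<subseteq> V - {v}" "X \<noteq> {}" if "X \<in> rooted V F v" for X
  proof -
    have "bipartition V {X, V - X}"
      using that F unfolding rooted_def weakly_bipartitive_def by blast
    then show "X \<subseteq> V - {v}" "X \<noteq> {}"
      using that unfolding bipartition_doubleton_iff rooted_def by auto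
  qed
qed (use rooted_crossing[OF F v(1)] in blast)+

lemma rooted_partitive:
  assumes F: "bipartitive V F" and v: "v \<in> V" "V \<noteq> {v}"
  shows "partitive (V - {v}) (rooted V F v)"
  unfolding partitive_def
proof (intro conjI ballI impI)
  have w: "weakly_bipartitive V F" using F unfolding bipartitive_def by (elim conjE)
  show "weakly_partitive (V - {v}) (rooted V F v)" by (rule rooted_weakly_partitive[OF w v])
  fix X Y assume h: "X \<in> rooted V F v" "Y \<in> rooted V F v" "crossing X Y"
  have s: "X \<subseteq> V - {v}" "Y \<subseteq> V - {v}" and m: "{X, V - X} \<in> F" "{Y, V - Y} \<in> F"
    using h unfolding rooted_def by auto
  have "\<forall>X Y X' Y'. {X, Y} \<in> F \<and> {X', Y'} \<in> F \<and> overlap X Y X' Y' \<longrightarrow>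
      {sym_diff X X', sym_diff X Y'} \<in> F"
    using F unfolding bipartitive_def by (elim conjE)
  from this[rule_format, OF conjI, OF m(1) conjI, OF m(2) rooted_crossing(1)[OF w v(1) h]]
  have "{sym_diff X Y, sym_diff X (V - Y)} \<in> F" .
  moreover have "sym_diff X (V - Y) = V - sym_diff X Y" using s by blast
  ultimately have "{sym_diff X Y, V - sym_diff X Y} \<in> F" by simp
  moreover have "sym_diff X Y \<subseteq> V - {v}" using s by blast
  ultimately show "sym_diff X Y \<in> rooted V F v" unfolding rooted_def by simp
qed

section \<open>The matrix with a row and a column of ones\<close>

definition cone :: "'a \<Rightarrow> ('a \<Rightarrow> 'a \<Rightarrow> real) \<Rightarrow> 'a \<Rightarrow> 'a \<Rightarrow> real" where
  "cone v a x y = (if x = v \<or> y = v then 1 else a x y)"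

text \<open>
  The minors that use the row or column of ones say that the rows indexed by $X$ agree outside
  $X$, and likewise the columns; conversely constant rows are pairwise proportional.
\<close>
lemma cone_minors_vanish_iff_module:
  assumes v: "v \<in> V" and X: "X \<noteq> {}" "X \<subseteq> V - {v}"
  shows "minors_vanish (cone v a) X (V - X) \<and> minors_vanish (cone v a) (V - X) X \<longleftrightarrow>
    X \<in> modules (V - {v}) a"
proof
  assume h: "minors_vanish (cone v a) X (V - X) \<and> minors_vanish (cone v a) (V - X) X"
  show "X \<in> modules (V - {v}) a"
  proof (rule modulesI[OF X])
    fix x x' y assume m: "x \<in> X" "x' \<in> X" "y \<in> V - {v}" "y \<notin> X"
    have "cone v a x y * cone v a x' v = cone v a x v * cone v a x' y"
      "cone v a y x * cone v a v x' = cone v a y x' * cone v a v x"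
      using h m v X(2) unfolding minors_vanish_def by blast+
    moreover have "x \<noteq> v" "x' \<noteq> v" "y \<noteq> v" using m X by auto
    ultimately show "a x y = a x' y \<and> a y x = a y x'" by (simp add: cone_def)
  qed
next
  assume M: "X \<in> modules (V - {v}) a"
  have const: "cone v a x y = cone v a x' y" "cone v a y x = cone v a y x'"
    if "x \<in> X" "x' \<in> X" "y \<in> V - X" for x x' y
  proof -
    have "x \<noteq> v" "x' \<noteq> v" using that X by auto
    then show "cone v a x y = cone v a x' y" "cone v a y x = cone v a y x'"
      using modulesD(3,4)[OF M that(1,2), of y] that(3) by (auto simp: cone_def)
  qed
  show "minors_vanish (cone v a) X (V - X) \<and> minors_vanish (cone v a) (V - X) X"
    unfolding minors_vanish_def
  proof (intro conjI ballI)
    fix x x' y y' assume "x \<in> X" "x' \<in> X" "y \<in> V - X" "y' \<in> V - X"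
    then show "cone v a x y * cone v a x' y' = cone v a x y' * cone v a x' y"
      using const(1)[of x x' y] const(1)[of x x' y'] by simp
  next
    fix x x' y y' assume "x \<in> V - X" "x' \<in> V - X" "y \<in> X" "y' \<in> X"
    then show "cone v a x y * cone v a x' y' = cone v a x y' * cone v a x' y"
      using const(2)[of y y' x] const(2)[of y y' x'] by simp
  qed
qed

text \<open>
  Every cut separates $v$ from some index, where the entry is one; this gives irreducibility.
\<close>
lemma cone_matrix_represents:
  fixes a :: "nat \<Rightarrow> nat \<Rightarrow> real"
  assumes F: "\<And>P. P \<in> F \<Longrightarrow> bipartition {0..<n} P" and v: "v < n"
    and mods: "rooted {0..<n} F v = modules ({0..<n} - {v}) a"
  defines "A \<equiv> mat n n (\<lambda>(i,j). cone v a i j)"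
  shows "irreducible_mat A" and "F = HL_bipartitions A"
proof -
  let ?V = "{0..<n}"
  have A: "A \<in> carrier_mat n n" and entry: "\<And>i j. i \<in> ?V \<Longrightarrow> j \<in> ?V \<Longrightarrow> A $$ (i,j) = cone v a i j"
    unfolding A_def by auto
  show "irreducible_mat A"
    unfolding irreducible_mat_iff[OF A]
  proof (intro allI impI)
    fix X Y assume h: "X \<noteq> {} \<and> Y \<noteq> {} \<and> X \<inter> Y = {} \<and> X \<union> Y = ?V"
    have "v \<in> X \<union> Y" using h v by simp
    then have "\<exists>x\<in>X. \<exists>y\<in>Y. x = v \<or> y = v" using h by blast
    then obtain x y where xy: "x \<in> X" "y \<in> Y" "x = v \<or> y = v" by blast
    then have "x \<in> ?V" "y \<in> ?V" using h by blast+
    then have "A $$ (x,y) = 1" using xy(3) entry unfolding cone_def by simp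
    then show "\<exists>x\<in>X. \<exists>y\<in>Y. A $$ (x,y) \<noteq> 0" using xy(1,2) by (intro bexI[of _ x] bexI[of _ y]) simp_all
  qed
  have minors: "minors_vanish (\<lambda>i j. A $$ (i,j)) X Y \<longleftrightarrow> minors_vanish (cone v a) X Y"
    if "X \<subseteq> ?V" "Y \<subseteq> ?V" for X Y
  proof -
    have "A $$ (i,j) = cone v a i j" if "i \<in> X" "j \<in> Y" for i j
      using that \<open>X \<subseteq> ?V\<close> \<open>Y \<subseteq> ?V\<close> entry by blast
    then show ?thesis unfolding minors_vanish_def by simp
  qed
  have pointed: "{X,Y} \<in> F \<longleftrightarrow> {X,Y} \<in> HL_bipartitions A"
    if bip: "X \<noteq> {}" "Y \<noteq> {}" "X \<inter> Y = {}" "X \<union> Y = ?V" and vY: "v \<in> Y" for X Y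
  proof -
    have Y: "Y = ?V - X" and X: "X \<subseteq> ?V - {v}" using bip vY by blast+
    have "{X,Y} \<in> F \<longleftrightarrow> X \<in> modules (?V - {v}) a"
      unfolding mods[symmetric] rooted_def using X Y by simp
    also have "\<dots> \<longleftrightarrow> minors_vanish (cone v a) X Y \<and> minors_vanish (cone v a) Y X"
      using cone_minors_vanish_iff_module[of v ?V X a] bip(1) X v unfolding Y by simp
    also have "\<dots> \<longleftrightarrow> {X,Y} \<in> HL_bipartitions A"
      unfolding HL_bipartitions_iff[OF A] using bip minors[of X Y] minors[of Y X] by blast
    finally show ?thesis .
  qed
  have all: "{X,Y} \<in> F \<longleftrightarrow> {X,Y} \<in> HL_bipartitions A" if "bipartition ?V {X,Y}" for X Y
  proof -
    have b: "X \<noteq> {}" "Y \<noteq> {}" "X \<inter> Y = {}" "X \<union> Y = ?V"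
      using that unfolding bipartition_doubleton_iff by auto
    show ?thesis
    proof (cases "v \<in> Y")
      case True
      then show ?thesis by (rule pointed[OF b])
    next
      case False
      have "v \<in> X \<union> Y" unfolding b(4) using v by simp
      then have "v \<in> X" using False by blast
      moreover have "Y \<inter> X = {}" "Y \<union> X = ?V" using b by blast+
      ultimately have "{Y,X} \<in> F \<longleftrightarrow> {Y,X} \<in> HL_bipartitions A"
        using pointed[of Y X] b(1,2) by blast
      then show ?thesis by (simp only: insert_commute)
    qed
  qed
  have bipA: "bipartition ?V P" if "P \<in> HL_bipartitions A" for P
    using that A unfolding HL_bipartitions_def by auto
  have pair: "\<exists>X Y. P = {X,Y}" if "bipartition ?V P" for P
    using that unfolding bipartition_def by (metis card_2_iff)
  show "F = HL_bipartitions A"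
  proof (rule Set.set_eqI)
    fix P
    show "P \<in> F \<longleftrightarrow> P \<in> HL_bipartitions A"
    proof (cases "bipartition ?V P")
      case True
      then show ?thesis using pair[OF True] all by blast
    next
      case False
      then show ?thesis using F[of P] bipA[of P] by blast
    qed
  qed
qed

lemma HL_realisation:
  assumes n: "n \<ge> 2" and F: "weakly_bipartitive {0..<n} F"
  shows "\<exists>A :: real mat. A \<in> carrier_mat n n \<and> irreducible_mat A \<and>
    elements_mat A \<subseteq> {-1, 0, 1} \<and> F = HL_bipartitions A \<and>
    (bipartitive {0..<n} F \<longrightarrow> transpose_mat A = A)"
proof -
  have v: "0 \<in> {0..<n}" "{0..<n} \<noteq> {0}" using n by (auto simp: set_eq_iff intro!: exI[of _ 1])
  obtain a where range: "\<And>x y. a x y \<in> {-1,0,1}"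
    and mods: "rooted {0..<n} F 0 = modules ({0..<n} - {0}) a"
    and symm: "partitive ({0..<n} - {0}) (rooted {0..<n} F 0) \<longrightarrow> (\<forall>x y. a x y = a y x)"
    using weakly_partitive_representation[OF finite_Diff[OF finite_atLeastLessThan]
        rooted_weakly_partitive[OF F v]] by blast
  define A where "A = mat n n (\<lambda>(i,j). cone 0 a i j)"
  have "irreducible_mat A" "F = HL_bipartitions A"
    unfolding A_def
    by (rule cone_matrix_represents[OF _ _ mods]; use F n in \<open>auto simp: weakly_bipartitive_def\<close>)+
  moreover have A: "A \<in> carrier_mat n n" unfolding A_def by simp
  moreover have "elements_mat A \<subseteq> {-1,0,1}"
  proof
    fix e assume "e \<in> elements_mat A"
    then obtain i j where "i < n" "j < n" "e = A $$ (i,j)" using A by auto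
    then show "e \<in> {-1,0,1}" using range[of i j] unfolding A_def cone_def by auto
  qed
  moreover have "transpose_mat A = A" if "bipartitive {0..<n} F"
  proof -
    have "a x y = a y x" for x y using symm rooted_partitive[OF that v] by blast
    then show ?thesis unfolding A_def cone_def by (intro eq_matI) auto
  qed
  ultimately show ?thesis by blast
qed

theorem theorem1:
  fixes n :: nat
  assumes "n \<ge> 2"
  shows
    "(\<forall>A :: 'k::field mat.
        A \<in> carrier_mat n n \<and> transpose_mat A = A \<and> irreducible_mat A \<longrightarrow>
        bipartitive {0..<n} (HL_bipartitions A)) \<and>
     (\<forall>F. weakly_bipartitive {0..<n} F \<longrightarrow>
        (\<exists>A :: real mat. A \<in> carrier_mat n n \<and> irreducible_mat A \<and>
           elements_mat A \<subseteq> {-1, 0, 1} \<and> F = HL_bipartitions A)) \<and>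
     (\<forall>F. bipartitive {0..<n} F \<longrightarrow>
        (\<exists>A :: real mat. A \<in> carrier_mat n n \<and> irreducible_mat A \<and>
           elements_mat A \<subseteq> {-1, 0, 1} \<and> F = HL_bipartitions A \<and> transpose_mat A = A))"
proof (intro conjI allI impI)
  fix A :: "'k mat"
  assume "A \<in> carrier_mat n n \<and> transpose_mat A = A \<and> irreducible_mat A"
  then show "bipartitive {0..<n} (HL_bipartitions A)" using symmetric_HL_bipartitive assms by blast
next
  fix F assume "weakly_bipartitive {0..<n} F"
  then show "\<exists>A :: real mat. A \<in> carrier_mat n n \<and> irreducible_mat A \<and>
      elements_mat A \<subseteq> {-1, 0, 1} \<and> F = HL_bipartitions A"
    using HL_realisation[OF assms] by blast
next
  fix F assume F: "bipartitive {0..<n} F"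
  then have "weakly_bipartitive {0..<n} F" unfolding bipartitive_def by (elim conjE)
  then show "\<exists>A :: real mat. A \<in> carrier_mat n n \<and> irreducible_mat A \<and>
      elements_mat A \<subseteq> {-1, 0, 1} \<and> F = HL_bipartitions A \<and> transpose_mat A = A"
    using HL_realisation[OF assms] F by blast
qed

end
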